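(* Let $\langle\mathcal S,\mathcal A,\mathcal P,\mathcal R,\gamma\rangle$ be a discounted Markov decision process with $\gamma\in(0,1)$, let $\alpha>0$, $\epsilon>0$, and let $\pi$ be a stationary policy. Assume: (a) for each $s\in\mathcal S$, if $a\sim\pi(\cdot\mid s)$, then $\log\pi(a\mid s)$ is well defined almost surely; (b) $\sup_{(s,a)\in\mathcal S\times\mathcal A}\mathbb E_{r\sim R(s,a),\,(s',a')\sim\mathcal P^\pi(\cdot\mid s,a)}\bigl[|r-\gamma\alpha\log\pi(a'\mid s')|\bigr]<\infty$; (c) for every $F\in\mathcal X^{\mathrm{cdf}}$ and $x\in\mathbb R$, the map $(s,a)\mapsto\mathbb E_{r\sim R(s,a),\,(s',a')\sim\mathcal P^\pi(\cdot\mid s,a)}\bigl[F(s',a')\bigl(\tfrac{x-r}{\gamma}+\alpha\log\pi(a'\mid s')\bigr)\bigr]$ is measurable; (d) the CDF field of the policy-induced soft return-distribution field $\mathcal Z^\pi$ satisfies $F_{\mathcal Z^\pi}\in\mathcal X^{\mathrm{cdf}}$ (so that $F_{\mathcal Z^\pi}$ is the unique fixed point of $\mathcal T^\pi_{\mathrm{cdf}}$ in $\mathcal X^{\mathrm{cdf}}$). Let $\mathcal T^\pi:=\mathbb V\,\mathcal T^\pi_{\mathrm{cdf}}\,\mathbb V^{-1}$ on $\mathcal X^{\mathrm{adm}}$. Then $\nu^\pi:=\mathbb VF_{\mathcal Z^\pi}\in\mathcal X^{\mathrm{adm}}$ satisfies $\mathcal T^\pi\nu^\pi=\nu^\pi$,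 and it is the unique fixed point of $\mathcal T^\pi$ on $\mathcal X^{\mathrm{adm}}$.
   Context: MDP: $\mathcal S,\mathcal A$ are measurable spaces (states, actions), $\mathcal P(\cdot\mid s,a)$ is a transition kernel on $\mathcal S$, $\mathcal R:\mathcal S\times\mathcal A\times\mathcal S\to\mathbb R$ is a (measurable) reward function. A stationary policy $\pi$ assigns to each $s$ a probability distribution $\pi(\cdot\mid s)$ on $\mathcal A$; $\pi(a\mid s)$ denotes the value of its probability mass function / density. Sampling: $(s',a')\sim\mathcal P^\pi(\cdot\mid s,a)$ means $s'\sim\mathcal P(\cdot\mid s,a)$ and then $a'\sim\pi(\cdot\mid s')$; $r\sim R(s,a)$ denotes the one-step reward $r=\mathcal R(s,a,s')$ generated by the same next state $s'$. Soft return: for the trajectory with $S_{t+1}\sim\mathcal P(\cdot\mid S_t,A_t)$, $R_t=\mathcal R(S_t,A_t,S_{t+1})$ and subsequent actions drawn from $\pi$, $Z^\pi(s,a)$ is $Z_t^\pi:=R_t+\sum_{k\ge1}\gamma^k[R_{t+k}-\alpha\log\pi(A_{t+k}\mid S_{t+k})]$ (series assumed almost surely convergent) conditioned on $(S_t,A_t)=(s,a)$; its law does not depend on $t$. Put $\mathcal Z^\pi(s,a):=\mathrm{Law}(Z^\pi(s,a))$, and let $F_{\mathcal Z^\pi}(s,a)$ be the CDF of $\mathcal Z^\pi(s,a)$. It satisfies the Bellman equation $Z^\pi(s,a)=R(s,a)+\gamma(Z^\pi(s',a')-\alpha\log\pi(a'\mid s'))$ in law, with $(s',a')\sim\mathcal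 P^\pi(\cdot\mid s,a)$ and $R(s,a)$ the one-step reward. CDF domain: $\Gamma_F$ is the set of CDFs $F$ on $\mathbb R$ with $\int_{\mathbb R}(F(x)-\mathbf 1\{x\ge0\})^2dx<\infty$. $\mathcal X^{\mathrm{cdf}}$ is the set of all CDF fields $F:(s,a)\mapsto F(s,a)\in\Gamma_F$ (with $(s,a)\mapsto F(s,a)(x)$ measurable for each $x\in\mathbb R$) such that $\sup_{(s,a)}\int_{\mathbb R}(F(s,a)(x)-\mathbf 1\{x\ge0\})^2dx<\infty$. Operator: for $F\in\mathcal X^{\mathrm{cdf}}$, $(\mathcal T^\pi_{\mathrm{cdf}}F)(s,a)(x):=\mathbb E_{r\sim R(s,a),\,(s',a')\sim\mathcal P^\pi(\cdot\mid s,a)}\bigl[F(s',a')\bigl(\tfrac{x-r}{\gamma}+\alpha\log\pi(a'\mid s')\bigr)\bigr]$. Spectral transport: $\widehat f(\omega)=\frac1{\sqrt{2\pi}}\int f(x)e^{-i\omega x}dx$ is the unitary Fourier transform. For fixed $\epsilon>0$, $\mathcal H^{\mathrm{cdf}}_\epsilon=\{H:\int\frac{\omega^2}{\omega^2+\epsilon}|\widehat H(\omega)|^2d\omega<\infty\}$ and $\mathcal H_\epsilon=\{f:\|f\|^2_{\mathcal H_\epsilon}=\frac1{2\pi}\int\frac{|\widehat f(\omega)|^2}{\omega^2+\epsilon}d\omega<\infty\}$ (elements understood through their Fourier transforms). Centring: $C(F)=F-\mathbf 1\{\cdot\ge0\}$. $\mathcal U:\mathcal H^{\mathrm{cdf}}_\epsilon\to\mathcal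 H_\epsilon$ is defined by $\widehat{\mathcal UH}(\omega)=-\sqrt{2\pi}\,i\omega\,\overline{\widehat H(\omega)}$. $\mathcal V:=\mathcal U\circ C:\Gamma_F\to\mathcal H_\epsilon$, which is injective. For $F\in\mathcal X^{\mathrm{cdf}}$, $(\mathbb VF)(s,a):=\mathcal V(F(s,a))$. $\mathcal X^{\mathrm{adm}}:=\mathrm{range}(\mathbb V)$, so $\mathbb V:\mathcal X^{\mathrm{cdf}}\to\mathcal X^{\mathrm{adm}}$ is bijective with inverse given by pointwise $\mathcal V^{-1}$. *)

theory Defs
  imports "HOL-Probability.Probability"
begin

section \<open>Markov decision processes and policies\<close>

record ('s, 'a) mdp =
  states :: "'s measure"
  actions :: "'a measure"
  trans_kernel :: "'s \<times> 'a \<Rightarrow> 's measure"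
  reward :: "'s \<times> 'a \<times> 's \<Rightarrow> real"
  discount :: real

abbreviation state_actions :: "('s, 'a) mdp \<Rightarrow> ('s \<times> 'a) measure" where
  "state_actions M \<equiv> states M \<Otimes>\<^sub>M actions M"

definition discounted_mdp :: "('s, 'a) mdp \<Rightarrow> bool" where
  "discounted_mdp M \<longleftrightarrow>
     trans_kernel M \<in> state_actions M \<rightarrow>\<^sub>M prob_algebra (states M) \<and>
     reward M \<in> borel_measurable (states M \<Otimes>\<^sub>M actions M \<Otimes>\<^sub>M states M) \<and>
     0 < discount M \<and> discount M < 1"

text \<open>
  A policy carries both its action distributions \<open>\<pi>(\<cdot> | s)\<close> and the values \<open>\<pi>(a | s)\<close> of their
  densities. The reference measure \<open>\<mu>\<close> is arbitrary: counting measure gives probability mass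
  functions, Lebesgue measure gives the usual densities.
\<close>

record ('s, 'a) policy =
  act_dist :: "'s \<Rightarrow> 'a measure"
  act_density :: "'s \<times> 'a \<Rightarrow> real"

definition stationary_policy :: "('s, 'a) mdp \<Rightarrow> ('s, 'a) policy \<Rightarrow> bool" where
  "stationary_policy M \<pi> \<longleftrightarrow>
     act_dist \<pi> \<in> states M \<rightarrow>\<^sub>M prob_algebra (actions M) \<and>
     act_density \<pi> \<in> borel_measurable (state_actions M) \<and>
     (\<exists>\<mu>. sets \<mu> = sets (actions M) \<and>
        (\<forall>s\<in>space (states M).
           (\<forall>a\<in>space (actions M). 0 \<le> act_density \<pi> (s, a)) \<and>
           act_dist \<pi> s = density \<mu> (\<lambda>a. ennreal (act_density \<pi> (s, a)))))"

definition log_policy :: "('s, 'a) policy \<Rightarrow> 's \<times> 'a \<Rightarrow> real" where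
  "log_policy \<pi> sa = ln (act_density \<pi> sa)"

text \<open>HOL totalizes \<open>ln 0 = 0\<close>, so well-definedness of the logarithm is positivity of its argument.\<close>

definition log_policy_well_defined :: "('s, 'a) mdp \<Rightarrow> ('s, 'a) policy \<Rightarrow> bool" where
  "log_policy_well_defined M \<pi> \<longleftrightarrow>
     (\<forall>s\<in>space (states M). AE a in act_dist \<pi> s. 0 < act_density \<pi> (s, a))"

text \<open>The law of \<open>(s', a')\<close> with \<open>s' \<sim> P(\<cdot> | s, a)\<close> and then \<open>a' \<sim> \<pi>(\<cdot> | s')\<close>.\<close>

definition next_pair :: "('s, 'a) mdp \<Rightarrow> ('s, 'a) policy \<Rightarrow> 's \<times> 'a \<Rightarrow> ('s \<times> 'a) measure" where
  "next_pair M \<pi> sa =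
     trans_kernel M sa \<bind> (\<lambda>s'. act_dist \<pi> s' \<bind> (\<lambda>a'. return (state_actions M) (s', a')))"

text \<open>
  The one-step reward is a function of the next state that is also used for sampling the next
  action, so expectations over \<open>r\<close> and \<open>(s', a')\<close> are integrals over \<open>next_pair\<close>.
\<close>

fun step_reward :: "('s, 'a) mdp \<Rightarrow> 's \<times> 'a \<Rightarrow> 's \<times> 'a \<Rightarrow> real" where
  "step_reward M (s, a) (s', a') = reward M (s, a, s')"


section \<open>The soft return\<close>

definition traj_kernel ::
    "('s, 'a) mdp \<Rightarrow> ('s, 'a) policy \<Rightarrow> 's \<times> 'a \<Rightarrow> nat \<Rightarrow> (nat \<Rightarrow> 's \<times> 'a) \<Rightarrow> ('s \<times> 'a) measure" where
  "traj_kernel M \<pi> sa n \<omega> =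
     (case n of 0 \<Rightarrow> return (state_actions M) sa | Suc m \<Rightarrow> next_pair M \<pi> (\<omega> m))"

text \<open>
  The law on sequences of the process \<open>(S\<^sub>t, A\<^sub>t)\<close> started in \<open>sa\<close>, by the Ionescu-Tulcea theorem.
\<close>

definition trajectory ::
    "('s, 'a) mdp \<Rightarrow> ('s, 'a) policy \<Rightarrow> 's \<times> 'a \<Rightarrow> (nat \<Rightarrow> 's \<times> 'a) measure" where
  "trajectory M \<pi> sa =
     projective_family.lim UNIV
       (Ionescu_Tulcea.CI (traj_kernel M \<pi> sa) (\<lambda>_. state_actions M)) (\<lambda>_. state_actions M)"

lemma measurable_next_pair:
  assumes "discounted_mdp M" and "stationary_policy M \<pi>"
  shows "next_pair M \<pi> \<in> state_actions M \<rightarrow>\<^sub>M prob_algebra (state_actions M)"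
proof -
  have [measurable]: "trans_kernel M \<in> state_actions M \<rightarrow>\<^sub>M prob_algebra (states M)"
    "act_dist \<pi> \<in> states M \<rightarrow>\<^sub>M prob_algebra (actions M)"
    using assms by (auto simp: discounted_mdp_def stationary_policy_def)
  show ?thesis
    unfolding next_pair_def by measurable
qed

lemma Ionescu_Tulcea_traj_kernel:
  assumes "discounted_mdp M" and "stationary_policy M \<pi>" and "sa \<in> space (state_actions M)"
  shows "Ionescu_Tulcea (traj_kernel M \<pi> sa) (\<lambda>_. state_actions M)"
proof -
  let ?S = "state_actions M"
  have *: "traj_kernel M \<pi> sa i \<in> PiM {0..<i} (\<lambda>_. ?S) \<rightarrow>\<^sub>M prob_algebra ?S" for i
  proof (cases i)
    case 0
    have "return ?S sa \<in> space (prob_algebra ?S)"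
      using assms(3) by (simp add: space_prob_algebra prob_space_return)
    then show ?thesis
      using 0 by (simp add: traj_kernel_def[abs_def])
  next
    case (Suc m)
    have "(\<lambda>\<omega>. \<omega> m) \<in> PiM {0..<i} (\<lambda>_. ?S) \<rightarrow>\<^sub>M ?S"
      by (rule measurable_component_singleton) (use Suc in simp)
    then have "(\<lambda>\<omega>. next_pair M \<pi> (\<omega> m)) \<in> PiM {0..<i} (\<lambda>_. ?S) \<rightarrow>\<^sub>M prob_algebra ?S"
      by (rule measurable_compose) (rule measurable_next_pair[OF assms(1,2)])
    then show ?thesis
      using Suc by (simp add: traj_kernel_def[abs_def])
  qed
  show ?thesis
  proof (rule Ionescu_Tulcea.intro)
    show "traj_kernel M \<pi> sa i \<in> PiM {0..<i} (\<lambda>_. ?S) \<rightarrow>\<^sub>M subprob_algebra ?S" for i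
      using * by (rule measurable_prob_algebraD)
    show "prob_space (traj_kernel M \<pi> sa i x)" if "x \<in> space (PiM {0..<i} (\<lambda>_. ?S))" for i x
      using measurable_space[OF * that] by (simp add: space_prob_algebra)
  qed
qed

text \<open>The summand of index \<open>k\<close> is the one belonging to time \<open>k + 1\<close>.\<close>

definition return_term ::
    "('s, 'a) mdp \<Rightarrow> ('s, 'a) policy \<Rightarrow> real \<Rightarrow> (nat \<Rightarrow> 's \<times> 'a) \<Rightarrow> nat \<Rightarrow> real" where
  "return_term M \<pi> \<alpha> \<omega> k =
     discount M ^ Suc k *
       (step_reward M (\<omega> (Suc k)) (\<omega> (Suc (Suc k))) - \<alpha> * log_policy \<pi> (\<omega> (Suc k)))"

definition soft_return ::
    "('s, 'a) mdp \<Rightarrow> ('s, 'a) policy \<Rightarrow> real \<Rightarrow> (nat \<Rightarrow> 's \<times> 'a) \<Rightarrow> real" where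
  "soft_return M \<pi> \<alpha> \<omega> = step_reward M (\<omega> 0) (\<omega> 1) + (\<Sum>k. return_term M \<pi> \<alpha> \<omega> k)"

definition soft_return_converges :: "('s, 'a) mdp \<Rightarrow> ('s, 'a) policy \<Rightarrow> real \<Rightarrow> bool" where
  "soft_return_converges M \<pi> \<alpha> \<longleftrightarrow>
     (\<forall>sa\<in>space (state_actions M). AE \<omega> in trajectory M \<pi> sa. summable (return_term M \<pi> \<alpha> \<omega>))"

definition soft_return_law ::
    "('s, 'a) mdp \<Rightarrow> ('s, 'a) policy \<Rightarrow> real \<Rightarrow> 's \<times> 'a \<Rightarrow> real measure" where
  "soft_return_law M \<pi> \<alpha> sa = distr (trajectory M \<pi> sa) borel (soft_return M \<pi> \<alpha>)"

definition soft_return_cdf ::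
    "('s, 'a) mdp \<Rightarrow> ('s, 'a) policy \<Rightarrow> real \<Rightarrow> 's \<times> 'a \<Rightarrow> real \<Rightarrow> real" where
  "soft_return_cdf M \<pi> \<alpha> = (\<lambda>sa\<in>space (state_actions M). cdf (soft_return_law M \<pi> \<alpha> sa))"


section \<open>The CDF domain and the CDF Bellman operator\<close>

definition centre :: "(real \<Rightarrow> real) \<Rightarrow> real \<Rightarrow> real" where
  "centre F x = F x - indicator {0..} x"

definition centred_energy :: "(real \<Rightarrow> real) \<Rightarrow> ennreal" where
  "centred_energy F = (\<integral>\<^sup>+x. ennreal ((centre F x)\<^sup>2) \<partial>lborel)"

definition Gamma_F :: "(real \<Rightarrow> real) set" where
  "Gamma_F = {F. (\<exists>\<mu>. real_distribution \<mu> \<and> F = cdf \<mu>) \<and> centred_energy F < \<infinity>}"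

text \<open>
  Fields are functions on the set of state-action pairs; they are extensional so that
  equality of fields is equality on that set.
\<close>

definition X_cdf :: "('s, 'a) mdp \<Rightarrow> ('s \<times> 'a \<Rightarrow> real \<Rightarrow> real) set" where
  "X_cdf M =
     {F \<in> space (state_actions M) \<rightarrow>\<^sub>E Gamma_F.
        (\<forall>x. (\<lambda>sa. F sa x) \<in> borel_measurable (state_actions M)) \<and>
        (SUP sa\<in>space (state_actions M). centred_energy (F sa)) < \<infinity>}"

definition bellman_mean ::
    "('s, 'a) mdp \<Rightarrow> ('s, 'a) policy \<Rightarrow> real \<Rightarrow> ('s \<times> 'a \<Rightarrow> real \<Rightarrow> real) \<Rightarrow> 's \<times> 'a \<Rightarrow> real \<Rightarrow> real" where
  "bellman_mean M \<pi> \<alpha> F sa x =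
     (\<integral>q. F q ((x - step_reward M sa q) / discount M + \<alpha> * log_policy \<pi> q) \<partial>next_pair M \<pi> sa)"

definition T_cdf ::
    "('s, 'a) mdp \<Rightarrow> ('s, 'a) policy \<Rightarrow> real \<Rightarrow> ('s \<times> 'a \<Rightarrow> real \<Rightarrow> real) \<Rightarrow> 's \<times> 'a \<Rightarrow> real \<Rightarrow> real" where
  "T_cdf M \<pi> \<alpha> F = (\<lambda>sa\<in>space (state_actions M). bellman_mean M \<pi> \<alpha> F sa)"


section \<open>Spectral transport\<close>

definition fourier_L1 :: "(real \<Rightarrow> complex) \<Rightarrow> real \<Rightarrow> complex" where
  "fourier_L1 f \<omega> = complex_of_real (1 / sqrt (2 * pi)) *
     (\<integral>x. f x * exp (- (\<i> * complex_of_real \<omega> * complex_of_real x)) \<partial>lborel)"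

text \<open>
  The elements of the two spectral spaces are represented by their Fourier transforms, that is,
  by almost-everywhere classes of measurable functions on the frequency line.
\<close>

type_synonym spectrum = "(real \<Rightarrow> complex) set"

definition ae_class :: "(real \<Rightarrow> complex) \<Rightarrow> spectrum" where
  "ae_class h = {g \<in> borel_measurable borel. AE \<omega> in lborel. g \<omega> = h \<omega>}"

text \<open>
  The unitary Fourier transform of a square-integrable function need not be given by an absolutely
  convergent integral; it is the limit in mean square of the transforms of the truncations.
\<close>

definition fourier_L2 :: "(real \<Rightarrow> complex) \<Rightarrow> spectrum" where
  "fourier_L2 f = {g \<in> borel_measurable borel.
     (\<lambda>n. \<integral>\<^sup>+\<omega>. ennreal ((cmod (g \<omega> - fourier_L1 (\<lambda>x. indicator {- real n..real n} x * f x) \<omega>))\<^sup>2)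
        \<partial>lborel) \<longlonglongrightarrow> 0}"

definition H_cdf :: "real \<Rightarrow> spectrum set" where
  "H_cdf \<epsilon> = {ae_class h |h. h \<in> borel_measurable borel \<and>
     (\<integral>\<^sup>+\<omega>. ennreal (\<omega>\<^sup>2 / (\<omega>\<^sup>2 + \<epsilon>) * (cmod (h \<omega>))\<^sup>2) \<partial>lborel) < \<infinity>}"

definition H_spec :: "real \<Rightarrow> spectrum set" where
  "H_spec \<epsilon> = {ae_class f |f. f \<in> borel_measurable borel \<and>
     ennreal (1 / (2 * pi)) * (\<integral>\<^sup>+\<omega>. ennreal ((cmod (f \<omega>))\<^sup>2 / (\<omega>\<^sup>2 + \<epsilon>)) \<partial>lborel) < \<infinity>}"

definition U_mult :: "(real \<Rightarrow> complex) \<Rightarrow> real \<Rightarrow> complex" where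
  "U_mult h \<omega> = - (complex_of_real (sqrt (2 * pi)) * \<i> * complex_of_real \<omega> * cnj (h \<omega>))"

definition U_op :: "real \<Rightarrow> spectrum \<Rightarrow> spectrum" where
  "U_op \<epsilon> = (\<lambda>H\<in>H_cdf \<epsilon>. \<Union>h\<in>H. ae_class (U_mult h))"

lemma U_mult_measurable:
  "h \<in> borel_measurable borel \<Longrightarrow> U_mult h \<in> borel_measurable borel"
proof -
  assume [measurable]: "h \<in> borel_measurable borel"
  have "(\<lambda>\<omega>. cnj (h \<omega>)) \<in> borel_measurable borel"
    by (rule borel_measurable_continuous_on[of cnj]) (auto intro: continuous_intros)
  then show ?thesis
    unfolding U_mult_def[abs_def] by measurable
qed

lemma U_op_ae_class:
  assumes "h \<in> borel_measurable borel" and "ae_class h \<in> H_cdf \<epsilon>"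
  shows "U_op \<epsilon> (ae_class h) = ae_class (U_mult h)"
proof -
  have "h \<in> ae_class h"
    using assms(1) by (simp add: ae_class_def)
  moreover have "ae_class (U_mult g) \<subseteq> ae_class (U_mult h)" if "g \<in> ae_class h" for g
  proof
    fix f assume "f \<in> ae_class (U_mult g)"
    with that have f: "f \<in> borel_measurable borel" and "AE \<omega> in lborel. g \<omega> = h \<omega>"
      and "AE \<omega> in lborel. f \<omega> = U_mult g \<omega>"
      by (auto simp: ae_class_def)
    then have "AE \<omega> in lborel. f \<omega> = U_mult h \<omega>"
      by (auto simp: U_mult_def)
    with f show "f \<in> ae_class (U_mult h)"
      by (simp add: ae_class_def)
  qed
  ultimately show ?thesis
    using assms(2) by (auto simp: U_op_def)
qed

lemma U_op_in_H_spec: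
  assumes "0 < \<epsilon>" and "H \<in> H_cdf \<epsilon>"
  shows "U_op \<epsilon> H \<in> H_spec \<epsilon>"
proof -
  obtain h where h: "h \<in> borel_measurable borel" "H = ae_class h"
    and fin: "(\<integral>\<^sup>+\<omega>. ennreal (\<omega>\<^sup>2 / (\<omega>\<^sup>2 + \<epsilon>) * (cmod (h \<omega>))\<^sup>2) \<partial>lborel) < \<infinity>"
    using assms(2) by (auto simp: H_cdf_def)
  note [measurable] = h(1)
  have eq: "(cmod (U_mult h \<omega>))\<^sup>2 / (\<omega>\<^sup>2 + \<epsilon>) = 2 * pi * (\<omega>\<^sup>2 / (\<omega>\<^sup>2 + \<epsilon>) * (cmod (h \<omega>))\<^sup>2)" for \<omega>
    by (simp add: U_mult_def norm_mult power_mult_distrib)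
  have "(\<integral>\<^sup>+\<omega>. ennreal ((cmod (U_mult h \<omega>))\<^sup>2 / (\<omega>\<^sup>2 + \<epsilon>)) \<partial>lborel) =
      (\<integral>\<^sup>+\<omega>. ennreal (2 * pi) * ennreal (\<omega>\<^sup>2 / (\<omega>\<^sup>2 + \<epsilon>) * (cmod (h \<omega>))\<^sup>2) \<partial>lborel)"
    unfolding eq using assms(1) by (intro nn_integral_cong ennreal_mult) auto
  also have "\<dots> = ennreal (2 * pi) * (\<integral>\<^sup>+\<omega>. ennreal (\<omega>\<^sup>2 / (\<omega>\<^sup>2 + \<epsilon>) * (cmod (h \<omega>))\<^sup>2) \<partial>lborel)"
    by (rule nn_integral_cmult) measurable
  finally have "ennreal (1 / (2 * pi)) *
      (\<integral>\<^sup>+\<omega>. ennreal ((cmod (U_mult h \<omega>))\<^sup>2 / (\<omega>\<^sup>2 + \<epsilon>)) \<partial>lborel) < \<infinity>"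
    using fin by (simp add: ennreal_mult_less_top)
  moreover have "U_op \<epsilon> H = ae_class (U_mult h)"
    using U_op_ae_class[OF h(1)] assms(2) h(2) by simp
  ultimately show ?thesis
    using U_mult_measurable[OF h(1)] unfolding H_spec_def by blast
qed

definition V_op :: "real \<Rightarrow> (real \<Rightarrow> real) \<Rightarrow> spectrum" where
  "V_op \<epsilon> F = U_op \<epsilon> (fourier_L2 (\<lambda>x. complex_of_real (centre F x)))"

definition V_field ::
    "('s, 'a) mdp \<Rightarrow> real \<Rightarrow> ('s \<times> 'a \<Rightarrow> real \<Rightarrow> real) \<Rightarrow> 's \<times> 'a \<Rightarrow> spectrum" where
  "V_field M \<epsilon> F = (\<lambda>sa\<in>space (state_actions M). V_op \<epsilon> (F sa))"

definition X_adm :: "('s, 'a) mdp \<Rightarrow> real \<Rightarrow> ('s \<times> 'a \<Rightarrow> spectrum) set" where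
  "X_adm M \<epsilon> = V_field M \<epsilon> ` X_cdf M"

definition T_spec ::
    "('s, 'a) mdp \<Rightarrow> ('s, 'a) policy \<Rightarrow> real \<Rightarrow> real \<Rightarrow> ('s \<times> 'a \<Rightarrow> spectrum) \<Rightarrow> 's \<times> 'a \<Rightarrow> spectrum" where
  "T_spec M \<pi> \<alpha> \<epsilon> = V_field M \<epsilon> \<circ> T_cdf M \<pi> \<alpha> \<circ> the_inv_into (X_cdf M) (V_field M \<epsilon>)"

end

theory Submission
  imports Defs
begin

text \<open>
  The operator on spectra is conjugate to the CDF Bellman operator, so everything follows from three
  facts. (1) The transport is injective: for the CDF of a distribution \<open>\<mu>\<close> with characteristic function
  \<open>\<phi>\<close>, the transform of the centred CDF is \<open>\<i> (1 - \<phi>(-\<omega>)) / (\<omega> \<surd>(2\<pi>))\<close>, first as a pointwise limit of the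
  transforms of the truncations, then in mean square by Bessel's inequality and Fatou's lemma; hence
  it determines \<open>\<phi>\<close>, and so \<open>\<mu>\<close>. (2) The CDF field of the soft return is a fixed point: splitting off
  the first transition (Markov property of the Ionescu-Tulcea measure) turns the event
  \<open>Z \<le> x\<close> into \<open>Z' \<le> (x - r) / \<gamma> + \<alpha> log \<pi>(a' | s')\<close>. (3) The fixed point is unique: by Jensen's
  inequality and an affine substitution the Bellman operator contracts the supremum of the squared
  \<open>L\<^sup>2\<close> distance by \<open>\<gamma>\<close>. For (3) to apply to a fixed point on the spectral side, the Bellman operator has to
  keep the values in \<open>\<Gamma>\<^sub>F\<close>, because the transport is injective only there; this uses the bound on the
  expected shift.
\<close>

section \<open>Fourier transforms\<close>

text \<open>\<open>fourier_L2\<close> is the set of all mean-square limits, so it carries no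
  information until a limit is exhibited. For a centred CDF the limit is known in closed form; an
  upper bound for integrable functions together with Fatou's lemma then does the work of
  completeness. The closed form is the one that \<open>U_mult\<close> sends to
  \<open>char \<mu> \<omega> - 1\<close> for \<omega> \<noteq> 0: centring by the step at 0
  subtracts the characteristic function of the point mass at 0. The constant \<gamma> comes from
  Lebesgue measure: the Bellman operator reads \<open>F\<close> at an argument that is affine in x
  with slope 1/\<gamma>, so squared L^2 norms in x shrink by \<gamma>. The same substitution
  controls the energy, except that centring does not commute with the shift. The defect is an
  average of differences of two step functions, whose squared L^2 norm is exactly the size of the
  shift; this is why a first moment is the right assumption. States and actions carry no topology,
  so joint measurability of a field has to come from right continuity of its values, and starting
  points of trajectories have to be handled without measurable singletons.\<close>

lemma measurable_fourier_L1[measurable]: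
  assumes [measurable]: "f \<in> borel_measurable borel"
  shows "fourier_L1 f \<in> borel_measurable borel"
  unfolding fourier_L1_def[abs_def] by measurable

section \<open>Gaussian integrals and Bessel's inequality for integrable real functions\<close>

lemma integral_std_normal_iexp:
  "(CLBINT x. complex_of_real (std_normal_density x) * iexp (t * x)) = complex_of_real (exp (- (t\<^sup>2) / 2))"
proof -
  have "char std_normal_distribution t = (CLBINT x. std_normal_density x *\<^sub>R iexp (t * x))"
    unfolding char_def by (subst integral_density) (auto simp: normal_density_nonneg)
  then show ?thesis
    by (simp add: char_std_normal_distribution scaleR_conv_of_real)
qed

text \<open>The characteristic function of the standard normal law, rescaled by \<delta>. The value
  is expressed through a normal density because its total mass is then known; the factor 2\<pi> will
  cancel the 1/(2\<pi>) of the squared unitary transform.\<close>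

lemma integral_gaussian_iexp:
  assumes "0 < \<delta>"
  shows "(CLBINT x. complex_of_real (exp (- ((\<delta> * x)\<^sup>2) / 2)) * iexp (x * t)) =
    complex_of_real (2 * pi * normal_density 0 \<delta> t)"
proof -
  have "(CLBINT x. complex_of_real (std_normal_density x) * iexp ((t / \<delta>) * x)) =
    \<bar>\<delta>\<bar> *\<^sub>R (CLBINT x. complex_of_real (std_normal_density (0 + \<delta> * x)) * iexp ((t / \<delta>) * (0 + \<delta> * x)))"
    using assms by (intro lborel_integral_real_affine) auto
  also have "(CLBINT x. complex_of_real (std_normal_density (0 + \<delta> * x)) * iexp ((t / \<delta>) * (0 + \<delta> * x)))
     = (CLBINT x. complex_of_real (1 / sqrt (2 * pi)) * (complex_of_real (exp (- ((\<delta> * x)\<^sup>2) / 2)) * iexp (x * t)))"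
    using assms by (intro Bochner_Integration.integral_cong) (auto simp: std_normal_density_def mult_ac)
  also have "\<dots> = complex_of_real (1 / sqrt (2 * pi)) * (CLBINT x. complex_of_real (exp (- ((\<delta> * x)\<^sup>2) / 2)) * iexp (x * t))"
    by (rule integral_mult_right_zero)
  finally have *: "complex_of_real (exp (- ((t / \<delta>)\<^sup>2) / 2)) = complex_of_real (\<delta> / sqrt (2 * pi)) *
     (CLBINT x. complex_of_real (exp (- ((\<delta> * x)\<^sup>2) / 2)) * iexp (x * t))"
    using assms unfolding integral_std_normal_iexp by (simp add: scaleR_conv_of_real)
  have "2 * pi * normal_density 0 \<delta> t = sqrt (2 * pi) / \<delta> * exp (- ((t / \<delta>)\<^sup>2) / 2)"
    using assms by (simp add: normal_density_def real_sqrt_mult power_divide field_simps)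
  then have "complex_of_real (2 * pi * normal_density 0 \<delta> t) =
      complex_of_real (sqrt (2 * pi) / \<delta>) * complex_of_real (exp (- ((t / \<delta>)\<^sup>2) / 2))"
    by simp
  also have "\<dots> = (complex_of_real (sqrt (2 * pi) / \<delta>) * complex_of_real (\<delta> / sqrt (2 * pi))) *
     (CLBINT x. complex_of_real (exp (- ((\<delta> * x)\<^sup>2) / 2)) * iexp (x * t))"
    unfolding * by (simp only: mult.assoc)
  also have "complex_of_real (sqrt (2 * pi) / \<delta>) * complex_of_real (\<delta> / sqrt (2 * pi)) = 1"
    using assms by (simp add: of_real_mult[symmetric] del: of_real_mult)
  finally show ?thesis by simp
qed

lemma integrable_gaussian:
  assumes "0 < \<delta>"
  shows "integrable lborel (\<lambda>x::real. exp (- ((\<delta> * x)\<^sup>2) / 2))"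
proof -
  have "integrable lborel (\<lambda>x. normal_density 0 1 (0 + \<delta> * x))"
    using assms by (subst lborel_integrable_real_affine_iff) (auto simp: integrable_normal_density)
  then have "integrable lborel (\<lambda>x. sqrt (2 * pi) * normal_density 0 1 (0 + \<delta> * x))"
    by (rule integrable_mult_right)
  then show ?thesis by (simp add: std_normal_density_def)
qed

lemma (in pair_sigma_finite) integrable_product_mult:
  fixes f :: "'a \<Rightarrow> 'c::{real_normed_algebra, banach, second_countable_topology}"
  assumes f: "integrable M1 f" and g: "integrable M2 g"
  shows "integrable (M1 \<Otimes>\<^sub>M M2) (\<lambda>(x, y). f x * g y)"
proof -
  have [measurable]: "f \<in> borel_measurable M1" "g \<in> borel_measurable M2"
    using f g by auto
  have "(\<integral>\<^sup>+z. ennreal (norm (case z of (x, y) \<Rightarrow> f x * g y)) \<partial>(M1 \<Otimes>\<^sub>M M2))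
     \<le> (\<integral>\<^sup>+z. ennreal (norm (f (fst z))) * ennreal (norm (g (snd z))) \<partial>(M1 \<Otimes>\<^sub>M M2))"
    by (intro nn_integral_mono) (auto simp: ennreal_mult[symmetric] split_beta intro!: ennreal_leI norm_mult_ineq)
  also have "\<dots> = (\<integral>\<^sup>+x. ennreal (norm (f x)) \<partial>M1) * (\<integral>\<^sup>+y. ennreal (norm (g y)) \<partial>M2)"
    by (subst M2.nn_integral_fst[symmetric]) (auto simp: nn_integral_cmult nn_integral_multc)
  also have "\<dots> < \<infinity>"
    using f g by (simp add: integrable_iff_bounded ennreal_mult_less_top)
  finally show ?thesis
    by (intro integrableI_bounded) auto
qed

text \<open>For real \<open>h\<close> conjugation only flips the phase, and the product of the two
  integrals is one integral over the plane. The frequency is left in the phase alone, from where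
  Fubini can integrate it out.\<close>

lemma fourier_L1_sq:
  assumes h: "integrable lborel (h :: real \<Rightarrow> real)"
  shows "complex_of_real ((cmod (fourier_L1 (\<lambda>x. complex_of_real (h x)) \<omega>))\<^sup>2) =
    complex_of_real (1 / (2 * pi)) *
     (\<integral>p. complex_of_real (h (fst p) * h (snd p)) * iexp (\<omega> * (snd p - fst p)) \<partial>(lborel \<Otimes>\<^sub>M lborel))"
proof -
  have [measurable]: "h \<in> borel_measurable borel" using h by auto
  let ?a = "\<lambda>x. complex_of_real (h x) * iexp (- (\<omega> * x))"
  let ?b = "\<lambda>x. complex_of_real (h x) * iexp (\<omega> * x)"
  have a: "integrable lborel ?a" and b: "integrable lborel ?b"
    by (rule Bochner_Integration.integrable_bound[OF h]; simp add: norm_mult)+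
  have F: "fourier_L1 (\<lambda>x. complex_of_real (h x)) \<omega> = complex_of_real (1 / sqrt (2 * pi)) * (\<integral>x. ?a x \<partial>lborel)"
    unfolding fourier_L1_def by (simp add: mult.assoc)
  have "cnj (\<integral>x. ?a x \<partial>lborel) = (\<integral>x. cnj (?a x) \<partial>lborel)"
    by (rule integral_bounded_linear[OF bounded_linear_cnj a, symmetric])
  also have "\<dots> = (\<integral>x. ?b x \<partial>lborel)"
    by (simp add: exp_cnj)
  finally have C: "cnj (\<integral>x. ?a x \<partial>lborel) = (\<integral>x. ?b x \<partial>lborel)" .
  have "complex_of_real ((cmod (fourier_L1 (\<lambda>x. complex_of_real (h x)) \<omega>))\<^sup>2) =
     complex_of_real (1 / sqrt (2 * pi)) * complex_of_real (1 / sqrt (2 * pi)) *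
       ((\<integral>x. ?a x \<partial>lborel) * (\<integral>x. ?b x \<partial>lborel))"
    unfolding complex_norm_square F complex_cnj_mult C complex_cnj_complex_of_real
    by (simp only: mult_ac)
  also have "complex_of_real (1 / sqrt (2 * pi)) * complex_of_real (1 / sqrt (2 * pi)) = complex_of_real (1 / (2 * pi))"
    by (simp add: of_real_mult[symmetric] del: of_real_mult)
  also have "(\<integral>x. ?a x \<partial>lborel) * (\<integral>x. ?b x \<partial>lborel) = (\<integral>x. (\<integral>y. ?a x * ?b y \<partial>lborel) \<partial>lborel)"
    by simp
  also have "\<dots> = (\<integral>p. ?a (fst p) * ?b (snd p) \<partial>(lborel \<Otimes>\<^sub>M lborel))"
    using lborel_pair.integral_fst'[OF lborel_pair.integrable_product_mult[OF a b]]
    by (simp add: case_prod_unfold)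
  also have "\<dots> = (\<integral>p. complex_of_real (h (fst p) * h (snd p)) * iexp (\<omega> * (snd p - fst p)) \<partial>(lborel \<Otimes>\<^sub>M lborel))"
    by (intro Bochner_Integration.integral_cong)
       (auto simp: algebra_simps exp_diff exp_minus divide_inverse)
  finally show ?thesis .
qed

text \<open>Integrating the frequency first leaves the double integral of h(x) h(y) against a normal
  density in y - x. Then h(x) h(y) is at most the mean of the two squares, and the density has mass
  one in either variable. The right-hand side may be infinite.\<close>

lemma fourier_L1_gaussian_le:
  assumes h: "integrable lborel (h :: real \<Rightarrow> real)" and "0 < \<delta>"
  shows "(\<integral>\<^sup>+\<omega>. ennreal (exp (- ((\<delta> * \<omega>)\<^sup>2) / 2) * (cmod (fourier_L1 (\<lambda>x. complex_of_real (h x)) \<omega>))\<^sup>2) \<partial>lborel)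
    \<le> (\<integral>\<^sup>+x. ennreal ((h x)\<^sup>2) \<partial>lborel)"
proof -
  have hm[measurable]: "h \<in> borel_measurable borel" using h by auto
  interpret P: pair_sigma_finite lborel "lborel \<Otimes>\<^sub>M lborel :: (real \<times> real) measure"
    by (intro pair_sigma_finite.intro sigma_finite_lborel lborel_pair.sigma_finite_measure_axioms)
  let ?G = "\<lambda>\<omega>::real. exp (- ((\<delta> * \<omega>)\<^sup>2) / 2)"
  let ?H = "\<lambda>p. h (fst p) * h (snd p)"
  let ?F = "\<lambda>\<omega>. (cmod (fourier_L1 (\<lambda>x. complex_of_real (h x)) \<omega>))\<^sup>2"
  let ?N = "\<lambda>p. normal_density 0 \<delta> (snd p - fst p)"
  have H: "integrable (lborel \<Otimes>\<^sub>M lborel) ?H"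
    using lborel_pair.integrable_product_mult[OF h h] by (simp add: case_prod_unfold)
  have GH: "integrable (lborel \<Otimes>\<^sub>M (lborel \<Otimes>\<^sub>M lborel))
      (\<lambda>(\<omega>, p). ?G \<omega> * ?H p)"
    by (rule P.integrable_product_mult[OF integrable_gaussian[OF assms(2)] H])
  let ?K = "\<lambda>\<omega> p. complex_of_real (?G \<omega>) * (complex_of_real (?H p) * iexp (\<omega> * (snd p - fst p)))"
  \<comment> \<open>The phase has modulus one, so the kernel is dominated by the Gaussian times the
    integrable product \<open>?H\<close>; this is what the damping buys.\<close>
  have K: "integrable (lborel \<Otimes>\<^sub>M (lborel \<Otimes>\<^sub>M lborel)) (\<lambda>(\<omega>, p). ?K \<omega> p)"
    by (rule Bochner_Integration.integrable_bound[OF GH]) (auto simp: norm_mult abs_mult)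
  have eq1: "complex_of_real (?G \<omega> * ?F \<omega>) = complex_of_real (1 / (2 * pi)) * (\<integral>p. ?K \<omega> p \<partial>(lborel \<Otimes>\<^sub>M lborel))" for \<omega>
    unfolding of_real_mult fourier_L1_sq[OF h] integral_mult_right_zero by (rule mult.left_commute)
  have "integrable lborel (\<lambda>\<omega>. \<integral>p. ?K \<omega> p \<partial>(lborel \<Otimes>\<^sub>M lborel))"
    using P.integrable_fst'[OF K] by simp
  then have "integrable lborel (\<lambda>\<omega>. complex_of_real (?G \<omega> * ?F \<omega>))"
    unfolding eq1 by (rule integrable_mult_right)
  then have iGF: "integrable lborel (\<lambda>\<omega>. ?G \<omega> * ?F \<omega>)"
    by (rule complex_of_real_integrable_eq[THEN iffD1])
  have "complex_of_real (\<integral>\<omega>. ?G \<omega> * ?F \<omega> \<partial>lborel) = (\<integral>\<omega>. complex_of_real (?G \<omega> * ?F \<omega>) \<partial>lborel)"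
    by (rule integral_complex_of_real[symmetric])
  also have "\<dots> = complex_of_real (1 / (2 * pi)) * (\<integral>\<omega>. \<integral>p. ?K \<omega> p \<partial>(lborel \<Otimes>\<^sub>M lborel) \<partial>lborel)"
    unfolding eq1 by (rule integral_mult_right_zero)
  also have "(\<integral>\<omega>. \<integral>p. ?K \<omega> p \<partial>(lborel \<Otimes>\<^sub>M lborel) \<partial>lborel) = (\<integral>p. \<integral>\<omega>. ?K \<omega> p \<partial>lborel \<partial>(lborel \<Otimes>\<^sub>M lborel))"
    by (rule P.Fubini_integral[OF K, symmetric])
  also have "\<dots> = (\<integral>p. complex_of_real (2 * pi * ?N p * ?H p) \<partial>(lborel \<Otimes>\<^sub>M lborel))"
  proof (intro Bochner_Integration.integral_cong refl)
    fix p :: "real \<times> real"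
    have "(\<integral>\<omega>. ?K \<omega> p \<partial>lborel) = (\<integral>\<omega>. complex_of_real (?H p) * (complex_of_real (?G \<omega>) * iexp (\<omega> * (snd p - fst p))) \<partial>lborel)"
      by (intro Bochner_Integration.integral_cong) (auto simp: mult_ac)
    also have "\<dots> = complex_of_real (?H p) * (\<integral>\<omega>. complex_of_real (?G \<omega>) * iexp (\<omega> * (snd p - fst p)) \<partial>lborel)"
      by (rule integral_mult_right_zero)
    also have "\<dots> = complex_of_real (?H p) * complex_of_real (2 * pi * ?N p)"
      unfolding integral_gaussian_iexp[OF assms(2)] ..
    finally show "(\<integral>\<omega>. ?K \<omega> p \<partial>lborel) = complex_of_real (2 * pi * ?N p * ?H p)"
      by (simp add: mult_ac)
  qed
  also have "\<dots> = complex_of_real (\<integral>p. 2 * pi * (?N p * ?H p) \<partial>(lborel \<Otimes>\<^sub>M lborel))"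
    by (simp add: mult.assoc del: of_real_mult integral_mult_right_zero)
  also have "(\<integral>p. 2 * pi * (?N p * ?H p) \<partial>(lborel \<Otimes>\<^sub>M lborel)) = 2 * pi * (\<integral>p. ?N p * ?H p \<partial>(lborel \<Otimes>\<^sub>M lborel))"
    by (rule integral_mult_right_zero)
  also have "complex_of_real (1 / (2 * pi)) * complex_of_real (2 * pi * (\<integral>p. ?N p * ?H p \<partial>(lborel \<Otimes>\<^sub>M lborel))) = 
     complex_of_real (\<integral>p. ?N p * ?H p \<partial>(lborel \<Otimes>\<^sub>M lborel))"
    by simp
  finally have main: "(\<integral>\<omega>. ?G \<omega> * ?F \<omega> \<partial>lborel) = (\<integral>p. ?N p * ?H p \<partial>(lborel \<Otimes>\<^sub>M lborel))"
    unfolding of_real_eq_iff .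
  \<comment> \<open>Mass one in each of the two variables, one for each half of the bound by
    squares.\<close>
  have N1: "(\<integral>\<^sup>+x. ennreal (normal_density 0 \<delta> (t - x)) \<partial>lborel) = 1"
    "(\<integral>\<^sup>+x. ennreal (normal_density 0 \<delta> (x - t)) \<partial>lborel) = 1" for t
  proof -
    have *: "(\<integral>\<^sup>+x. ennreal (normal_density t \<delta> x) \<partial>lborel) = 1"
      using assms(2) by (subst nn_integral_eq_integral) auto
    have "normal_density 0 \<delta> (t - x) = normal_density t \<delta> x" "normal_density 0 \<delta> (x - t) = normal_density t \<delta> x" for x
      by (auto simp: normal_density_def power2_commute)
    with * show "(\<integral>\<^sup>+x. ennreal (normal_density 0 \<delta> (t - x)) \<partial>lborel) = 1"
      "(\<integral>\<^sup>+x. ennreal (normal_density 0 \<delta> (x - t)) \<partial>lborel) = 1" by simp_all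
  qed
  \<comment> \<open>\<open>h\<close> is integrable but not assumed square-integrable, so
    integrability of the weighted product comes from the peak value of the density.\<close>
  have "normal_density 0 \<delta> t \<le> 1 / sqrt (2 * pi * \<delta>\<^sup>2)" for t
    unfolding normal_density_def by (intro mult_left_le) auto
  then have "normal_density 0 \<delta> t * c \<le> c / sqrt (2 * pi * \<delta>\<^sup>2)" if "0 \<le> c" for t c
    using mult_right_mono[OF _ that] by fastforce
  then have iNH: "integrable (lborel \<Otimes>\<^sub>M lborel) (\<lambda>p. ?N p * ?H p)"
    by (intro Bochner_Integration.integrable_bound[OF integrable_mult_right[OF H, of "1 / sqrt (2 * pi * \<delta>\<^sup>2)"]])
       (auto simp: abs_mult)
  have half: "ennreal (1/2) + ennreal (1/2) = 1"
    by (subst ennreal_plus[symmetric]) auto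
  let ?S = "\<integral>\<^sup>+x. ennreal ((h x)\<^sup>2) \<partial>lborel"
  have "(\<integral>\<^sup>+\<omega>. ennreal (?G \<omega> * ?F \<omega>) \<partial>lborel) = ennreal (\<integral>\<omega>. ?G \<omega> * ?F \<omega> \<partial>lborel)"
    by (rule nn_integral_eq_integral[OF iGF]) auto
  also have "\<dots> \<le> (\<integral>\<^sup>+p. ennreal (norm (?N p * ?H p)) \<partial>(lborel \<Otimes>\<^sub>M lborel))"
    unfolding main by (rule order_trans[OF ennreal_leI integral_norm_bound_ennreal[OF iNH]]) auto
  also have "\<dots> \<le> (\<integral>\<^sup>+p. ennreal (1/2) * (ennreal ((h (fst p))\<^sup>2) * ennreal (?N p)) +
        ennreal (1/2) * (ennreal ((h (snd p))\<^sup>2) * ennreal (?N p)) \<partial>(lborel \<Otimes>\<^sub>M lborel))"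
  proof (intro nn_integral_mono)
    fix p :: "real \<times> real"
    have "\<bar>?H p\<bar> \<le> 1/2 * (h (fst p))\<^sup>2 + 1/2 * (h (snd p))\<^sup>2"
      using sum_squares_bound[of "\<bar>h (fst p)\<bar>" "\<bar>h (snd p)\<bar>"] by (simp add: abs_mult)
    then have "\<bar>?H p\<bar> * ?N p \<le> (1/2 * (h (fst p))\<^sup>2 + 1/2 * (h (snd p))\<^sup>2) * ?N p"
      by (rule mult_right_mono) simp
    then have "ennreal (norm (?N p * ?H p)) \<le> ennreal (1/2 * ((h (fst p))\<^sup>2 * ?N p) + 1/2 * ((h (snd p))\<^sup>2 * ?N p))"
      by (intro ennreal_leI) (simp add: abs_mult algebra_simps)
    also have "\<dots> = ennreal (1/2) * (ennreal ((h (fst p))\<^sup>2) * ennreal (?N p)) +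
        ennreal (1/2) * (ennreal ((h (snd p))\<^sup>2) * ennreal (?N p))"
      by (simp only: ennreal_plus ennreal_mult mult_nonneg_nonneg zero_le_power2 normal_density_nonneg
          zero_le_divide_1_iff zero_le_numeral)
    finally show "ennreal (norm (?N p * ?H p)) \<le> \<dots>" .
  qed
  also have "\<dots> = ennreal (1/2) * (\<integral>\<^sup>+p. ennreal ((h (fst p))\<^sup>2) * ennreal (?N p) \<partial>(lborel \<Otimes>\<^sub>M lborel)) +
       ennreal (1/2) * (\<integral>\<^sup>+p. ennreal ((h (snd p))\<^sup>2) * ennreal (?N p) \<partial>(lborel \<Otimes>\<^sub>M lborel))"
    by (simp add: nn_integral_add nn_integral_cmult)
  also have "(\<integral>\<^sup>+p. ennreal ((h (fst p))\<^sup>2) * ennreal (?N p) \<partial>(lborel \<Otimes>\<^sub>M lborel)) = ?S"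
    by (subst lborel.nn_integral_fst[symmetric]) (simp_all add: nn_integral_cmult N1)
  also have "(\<integral>\<^sup>+p. ennreal ((h (snd p))\<^sup>2) * ennreal (?N p) \<partial>(lborel \<Otimes>\<^sub>M lborel)) = ?S"
    by (subst lborel_pair.nn_integral_snd[symmetric]) (simp_all add: nn_integral_cmult N1)
  also have "ennreal (1/2) * ?S + ennreal (1/2) * ?S = ?S"
    by (simp only: distrib_right[symmetric] half mult_1)
  finally show ?thesis .
qed

text \<open>A Gaussian damping factor makes the Fourier integral of the squared modulus absolutely convergent,
  and turns under Fubini into an averaging kernel of mass one; then the damping is removed by Fatou's lemma.\<close>

lemma fourier_L1_bessel:
  assumes h: "integrable lborel (h :: real \<Rightarrow> real)"
  shows "(\<integral>\<^sup>+\<omega>. ennreal ((cmod (fourier_L1 (\<lambda>x. complex_of_real (h x)) \<omega>))\<^sup>2) \<partial>lborel)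
    \<le> (\<integral>\<^sup>+x. ennreal ((h x)\<^sup>2) \<partial>lborel)"
proof -
  have [measurable]: "h \<in> borel_measurable borel" using h by auto
  let ?F = "\<lambda>\<omega>. (cmod (fourier_L1 (\<lambda>x. complex_of_real (h x)) \<omega>))\<^sup>2"
  let ?G = "\<lambda>n \<omega>::real. exp (- ((inverse (real (Suc n)) * \<omega>)\<^sup>2) / 2)"
  have lim: "(\<lambda>n. ennreal (?G n \<omega> * ?F \<omega>)) \<longlonglongrightarrow> ennreal (?F \<omega>)" for \<omega>
  proof -
    have "(\<lambda>n. exp (- ((inverse (real (Suc n)) * \<omega>)\<^sup>2) / 2) * ?F \<omega>) \<longlonglongrightarrow> exp (- ((0 * \<omega>)\<^sup>2) / 2) * ?F \<omega>"
      by (intro tendsto_intros LIMSEQ_inverse_real_of_nat) simp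
    then show ?thesis by (intro tendsto_ennrealI) simp
  qed
  have "(\<integral>\<^sup>+\<omega>. ennreal (?F \<omega>) \<partial>lborel) = (\<integral>\<^sup>+\<omega>. liminf (\<lambda>n. ennreal (?G n \<omega> * ?F \<omega>)) \<partial>lborel)"
    by (intro nn_integral_cong lim_imp_Liminf[symmetric] lim) simp
  also have "\<dots> \<le> liminf (\<lambda>n. \<integral>\<^sup>+\<omega>. ennreal (?G n \<omega> * ?F \<omega>) \<partial>lborel)"
    by (intro nn_integral_liminf) measurable
  also have "\<dots> \<le> liminf (\<lambda>n::nat. \<integral>\<^sup>+x. ennreal ((h x)\<^sup>2) \<partial>lborel)"
    by (intro Liminf_mono always_eventually allI fourier_L1_gaussian_le[OF h]) simp
  also have "\<dots> = (\<integral>\<^sup>+x. ennreal ((h x)\<^sup>2) \<partial>lborel)"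
    by (simp add: Liminf_const)
  finally show ?thesis .
qed

section \<open>From integrable functions to pointwise and mean-square limits\<close>

lemma fourier_L1_diff:
  assumes "integrable lborel f" "integrable lborel g"
  shows "fourier_L1 (\<lambda>x. complex_of_real (f x - g x)) \<omega> =
    fourier_L1 (\<lambda>x. complex_of_real (f x)) \<omega> - fourier_L1 (\<lambda>x. complex_of_real (g x)) \<omega>"
proof -
  let ?e = "\<lambda>x. exp (- (\<i> * complex_of_real \<omega> * complex_of_real x))"
  have [simp]: "cmod (?e x) = 1" for x
    using norm_exp_i_times[of "- (\<omega> * x)"] by (simp add: mult.assoc)
  have "integrable lborel (\<lambda>x. complex_of_real (f x) * ?e x)" "integrable lborel (\<lambda>x. complex_of_real (g x) * ?e x)"
    by (rule Bochner_Integration.integrable_bound[OF assms(1)] Bochner_Integration.integrable_bound[OF assms(2)];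
      use assms in \<open>auto simp: norm_mult intro!: borel_measurable_times\<close>)+
  then show ?thesis
    unfolding fourier_L1_def by (simp add: left_diff_distrib right_diff_distrib Bochner_Integration.integral_diff)
qed

text \<open>Bessel's inequality passes to pointwise limits of transforms by Fatou's lemma. It is
  used twice: for the transform of a centred CDF itself, and for its distance to a truncated
  transform. Frequency 0 is left out because the closed form divides by \<omega>.\<close>

lemma nn_integral_fourier_limit_le:
  fixes h :: "real \<Rightarrow> complex"
  assumes [measurable]: "h \<in> borel_measurable borel"
    and u: "\<And>m. integrable lborel (u m)"
    and lim: "\<And>\<omega>. \<omega> \<noteq> 0 \<Longrightarrow> (\<lambda>m. fourier_L1 (\<lambda>x. complex_of_real (u m x)) \<omega>) \<longlonglongrightarrow> h \<omega>"
    and bound: "\<forall>\<^sub>F m in sequentially. (\<integral>\<^sup>+x. ennreal ((u m x)\<^sup>2) \<partial>lborel) \<le> C"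
  shows "(\<integral>\<^sup>+\<omega>. ennreal ((cmod (h \<omega>))\<^sup>2) \<partial>lborel) \<le> C"
proof -
  have [measurable]: "u m \<in> borel_measurable borel" for m using u[of m] by auto
  let ?F = "\<lambda>m \<omega>. ennreal ((cmod (fourier_L1 (\<lambda>x. complex_of_real (u m x)) \<omega>))\<^sup>2)"
  have "AE \<omega> in lborel. ennreal ((cmod (h \<omega>))\<^sup>2) = liminf (\<lambda>m. ?F m \<omega>)"
    using AE_lborel_singleton[of 0]
  proof eventually_elim
    case (elim \<omega>)
    have "(\<lambda>m. ?F m \<omega>) \<longlonglongrightarrow> ennreal ((cmod (h \<omega>))\<^sup>2)"
      by (intro tendsto_ennrealI tendsto_power tendsto_norm lim elim)
    then show ?case by (intro lim_imp_Liminf[symmetric]) auto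
  qed
  then have "(\<integral>\<^sup>+\<omega>. ennreal ((cmod (h \<omega>))\<^sup>2) \<partial>lborel) = (\<integral>\<^sup>+\<omega>. liminf (\<lambda>m. ?F m \<omega>) \<partial>lborel)"
    by (rule nn_integral_cong_AE)
  also have "\<dots> \<le> liminf (\<lambda>m. \<integral>\<^sup>+\<omega>. ?F m \<omega> \<partial>lborel)"
    by (intro nn_integral_liminf) measurable
  also have "\<dots> \<le> liminf (\<lambda>m::nat. C)"
    by (intro Liminf_mono eventually_mono[OF bound] order_trans[OF fourier_L1_bessel[OF u]])
  also have "\<dots> = C"
    by (simp add: Liminf_const)
  finally show ?thesis .
qed

lemma cmod_sq_diff_le: "(cmod (a - b))\<^sup>2 \<le> 2 * (cmod (a - c))\<^sup>2 + 2 * (cmod (b - c))\<^sup>2"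
proof -
  have "cmod (a - b) \<le> cmod (a - c) + cmod (b - c)"
    using norm_triangle_ineq4[of "a - c" "b - c"] by simp
  then have "(cmod (a - b))\<^sup>2 \<le> (cmod (a - c) + cmod (b - c))\<^sup>2"
    by (rule power_mono) simp
  also have "\<dots> \<le> 2 * (cmod (a - c))\<^sup>2 + 2 * (cmod (b - c))\<^sup>2"
    using sum_squares_bound[of "cmod (a - c)" "cmod (b - c)"] by (simp add: power2_sum)
  finally show ?thesis .
qed

text \<open>Mean-square limits are unique up to null sets: the squared distance of two limits is at
  most twice the sum of their squared distances to any truncated transform. Since the set of limits
  could be empty, a member \<open>g\<close> has to be supplied.\<close>

lemma fourier_L2_eq_ae_class:
  assumes g: "g \<in> fourier_L2 f" and f[measurable]: "f \<in> borel_measurable borel"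
  shows "fourier_L2 f = ae_class g"
proof -
  have gm[measurable]: "g \<in> borel_measurable borel" using g by (simp add: fourier_L2_def)
  define fh where "fh n = fourier_L1 (\<lambda>x. indicator {- real n..real n} x * f x)" for n
  have [measurable]: "fh n \<in> borel_measurable borel" for n unfolding fh_def by measurable
  let ?D = "\<lambda>k n. \<integral>\<^sup>+\<omega>. ennreal ((cmod (k \<omega> - fh n \<omega>))\<^sup>2) \<partial>lborel"
  have mem: "k \<in> fourier_L2 f \<longleftrightarrow> k \<in> borel_measurable borel \<and> ?D k \<longlonglongrightarrow> 0" for k
    by (simp add: fourier_L2_def fh_def)
  show ?thesis
  proof (intro set_eqI iffI)
    fix k assume "k \<in> ae_class g"
    then have "k \<in> borel_measurable borel" and ae: "AE \<omega> in lborel. k \<omega> = g \<omega>"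
      by (auto simp: ae_class_def)
    have "?D k n = ?D g n" for n
      by (rule nn_integral_cong_AE) (use ae in eventually_elim, simp)
    then show "k \<in> fourier_L2 f"
      using g \<open>k \<in> borel_measurable borel\<close> by (simp add: mem)
  next
    fix k assume k: "k \<in> fourier_L2 f"
    then have [measurable]: "k \<in> borel_measurable borel" by (simp add: mem)
    let ?I = "\<integral>\<^sup>+\<omega>. ennreal ((cmod (k \<omega> - g \<omega>))\<^sup>2) \<partial>lborel"
    have "?I \<le> 2 * ?D k n + 2 * ?D g n" for n
    proof -
      have "?I \<le> (\<integral>\<^sup>+\<omega>. 2 * ennreal ((cmod (k \<omega> - fh n \<omega>))\<^sup>2) + 2 * ennreal ((cmod (g \<omega> - fh n \<omega>))\<^sup>2) \<partial>lborel)"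
      proof (intro nn_integral_mono)
        fix \<omega>
        have "ennreal ((cmod (k \<omega> - g \<omega>))\<^sup>2) \<le> ennreal (2 * (cmod (k \<omega> - fh n \<omega>))\<^sup>2 + 2 * (cmod (g \<omega> - fh n \<omega>))\<^sup>2)"
          by (intro ennreal_leI cmod_sq_diff_le)
        then show "ennreal ((cmod (k \<omega> - g \<omega>))\<^sup>2) \<le> 2 * ennreal ((cmod (k \<omega> - fh n \<omega>))\<^sup>2) + 2 * ennreal ((cmod (g \<omega> - fh n \<omega>))\<^sup>2)"
          by (simp add: ennreal_mult)
      qed
      also have "\<dots> = 2 * ?D k n + 2 * ?D g n"
        by (simp add: nn_integral_add nn_integral_cmult)
      finally show ?thesis .
    qed
    moreover have "(\<lambda>n. 2 * ?D k n + 2 * ?D g n) \<longlonglongrightarrow> 2 * 0 + 2 * 0"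
      using k g by (intro tendsto_add ennreal_tendsto_cmult) (auto simp: mem)
    ultimately have "?I \<le> 0"
      by (intro LIMSEQ_le_const[of "\<lambda>n. 2 * ?D k n + 2 * ?D g n"]) auto
    then have "AE \<omega> in lborel. k \<omega> = g \<omega>"
      by (simp add: nn_integral_0_iff_AE)
    then show "k \<in> ae_class g"
      by (simp add: ae_class_def)
  qed
qed

lemma fourier_L2_cong_AE:
  assumes "f \<in> borel_measurable borel" "g \<in> borel_measurable borel" "AE x in lborel. f x = g x"
  shows "fourier_L2 f = fourier_L2 g"
proof -
  have "fourier_L1 (\<lambda>x. indicator {- real n..real n} x * f x) \<omega> =
     fourier_L1 (\<lambda>x. indicator {- real n..real n} x * g x) \<omega>" for n \<omega>
    unfolding fourier_L1_def using assms
    by (intro arg_cong2[where f="(*)"] refl integral_cong_AE) auto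
  then show ?thesis by (simp add: fourier_L2_def)
qed

text \<open>The set of agreement is closed, and a closed set of full Lebesgue measure is the whole
  line. Applied to characteristic functions.\<close>

lemma AE_lborel_continuous_eq:
  fixes f g :: "real \<Rightarrow> complex"
  assumes "AE x in lborel. f x = g x" "\<And>x. isCont f x" "\<And>x. isCont g x"
  shows "f = g"
proof -
  have "closed {x. f x = g x}"
    using assms(2,3) by (intro closed_Collect_eq continuous_at_imp_continuous_on) auto
  with assms(1) have "AE x in lborel. x \<in> {x. f x = g x}" "closed {x. f x = g x}" by simp_all
  then have "x \<in> {x. f x = g x}" for x
    by (intro mem_closed_if_AE_lebesgue AE_completion)
  then show ?thesis by auto
qed

section \<open>The spectral transport on CDFs\<close>

lemma borel_measurable_centre[measurable]:
  assumes [measurable]: "F \<in> borel_measurable borel"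
  shows "centre F \<in> borel_measurable borel"
  unfolding centre_def[abs_def] by measurable

lemma (in real_distribution) borel_measurable_cdf: "cdf M \<in> borel_measurable borel"
  by (intro borel_measurable_mono monoI cdf_nondecreasing)

section \<open>The transform of a centred CDF in closed form\<close>

lemma interval_integral_iexp_scaled:
  assumes "\<omega> \<noteq> 0"
  shows "(CLBINT x=ereal a..ereal b. exp (- (\<i> * complex_of_real \<omega> * complex_of_real x))) =
    \<i> / complex_of_real \<omega> * (exp (- (\<i> * complex_of_real \<omega> * complex_of_real b)) - exp (- (\<i> * complex_of_real \<omega> * complex_of_real a)))"
proof (subst interval_integral_FTC_finite[where F="\<lambda>x. \<i> / complex_of_real \<omega> * exp (- (\<i> * complex_of_real \<omega> * complex_of_real x))"])
  fix x
  have "((\<lambda>z. \<i> / complex_of_real \<omega> * exp (- (\<i> * complex_of_real \<omega> * z))) has_field_derivative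
     exp (- (\<i> * complex_of_real \<omega> * complex_of_real x))) (at (complex_of_real x))"
    using assms by (auto intro!: derivative_eq_intros)
  from has_vector_derivative_real_field[OF this]
  show "((\<lambda>x. \<i> / complex_of_real \<omega> * exp (- (\<i> * complex_of_real \<omega> * complex_of_real x))) has_vector_derivative
     exp (- (\<i> * complex_of_real \<omega> * complex_of_real x))) (at x within {min a b..max a b})"
    by (rule has_vector_derivative_at_within)
qed (auto intro!: continuous_intros simp: algebra_simps)

text \<open>Inside the window and up to finitely many points, the difference of the steps is +1
  between \<open>y\<close> and 0 for negative \<open>y\<close>, and -1 between 0 and
  \<open>y\<close> for positive \<open>y\<close>. Both cases are the oriented integral from the
  clipped point \<open>c\<close> to 0.\<close>

lemma integral_step_difference:
  fixes y :: real
  assumes "\<omega> \<noteq> 0"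
  shows "(CLBINT x. indicator {- real n..real n} x * complex_of_real (indicator {y..} x - indicator {0..} x) *
        exp (- (\<i> * complex_of_real \<omega> * complex_of_real x))) =
     \<i> / complex_of_real \<omega> * (1 - exp (- (\<i> * complex_of_real \<omega> * complex_of_real (max (- real n) (min (real n) y)))))"
    (is "integral\<^sup>L lborel ?K = _")
proof -
  define c where "c = max (- real n) (min (real n) y)"
  let ?e = "\<lambda>x. exp (- (\<i> * complex_of_real \<omega> * complex_of_real x))"
  \<comment> \<open>The point \<open>real n\<close> is excluded because for \<open>y > n\<close> the
    step clipped to \<open>c = n\<close> has already jumped there while the original one has
    not.\<close>
  have ae: "AE x in lborel. x \<noteq> 0 \<and> x \<noteq> c \<and> x \<noteq> real n"
    by (intro AE_conjI AE_lborel_singleton)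
  have c: "- real n \<le> c" "c \<le> real n"
    by (simp_all add: c_def)
  have "y \<le> x \<longleftrightarrow> c \<le> x" if "- real n \<le> x" "x \<le> real n" "x \<noteq> real n" for x
    using that by (auto simp: c_def min_le_iff_disj)
  then have K_eq: "?K x = indicator {- real n..real n} x * complex_of_real (indicator {c..} x - indicator {0..} x) * ?e x"
    if "x \<noteq> real n" for x
    using that by (auto simp: indicator_def)
  have "integral\<^sup>L lborel ?K = (CLBINT x=ereal c..ereal 0. ?e x)"
  proof (cases "c \<le> 0")
    case True
    have "integral\<^sup>L lborel ?K = (CLBINT x. indicator {c<..<0} x *\<^sub>R ?e x)"
    proof (rule integral_cong_AE)
      show "AE x in lborel. ?K x = indicator {c<..<0} x *\<^sub>R ?e x"
        using ae by eventually_elim (use True c K_eq in \<open>auto simp: indicator_def\<close>)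
    qed measurable
    then show ?thesis
      using True by (simp add: interval_lebesgue_integral_def set_lebesgue_integral_def einterval_eq)
  next
    case False
    have "integral\<^sup>L lborel ?K = (CLBINT x. - (indicator {0<..<c} x *\<^sub>R ?e x))"
    proof (rule integral_cong_AE)
      show "AE x in lborel. ?K x = - (indicator {0<..<c} x *\<^sub>R ?e x)"
        using ae by eventually_elim (use False c K_eq in \<open>auto simp: indicator_def\<close>)
    qed measurable
    then show ?thesis
      using False by (simp add: interval_lebesgue_integral_def set_lebesgue_integral_def einterval_eq)
  qed
  then show ?thesis
    by (simp add: interval_integral_iexp_scaled[OF assms] c_def[symmetric])
qed

text \<open>Kept real-valued because Bessel's inequality above is for real functions;
  \<open>fourier_L2_of_real\<close> reconciles it with the complex truncation in
  \<open>fourier_L2\<close>.\<close>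

definition truncated :: "nat \<Rightarrow> (real \<Rightarrow> real) \<Rightarrow> real \<Rightarrow> real" where
  "truncated n f x = indicator {- real n..real n} x * f x"

lemma borel_measurable_truncated[measurable]:
  "f \<in> borel_measurable borel \<Longrightarrow> truncated n f \<in> borel_measurable borel"
  unfolding truncated_def[abs_def] by measurable

lemma fourier_L2_of_real:
  "fourier_L2 (\<lambda>x. complex_of_real (f x)) = {g \<in> borel_measurable borel.
     (\<lambda>n. \<integral>\<^sup>+\<omega>. ennreal ((cmod (g \<omega> - fourier_L1 (\<lambda>x. complex_of_real (truncated n f x)) \<omega>))\<^sup>2) \<partial>lborel) \<longlonglongrightarrow> 0}"
proof -
  have "indicator {- real n..real n} x * complex_of_real (f x) = complex_of_real (truncated n f x)" for n x
    by (simp add: truncated_def indicator_def)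
  then show ?thesis by (simp add: fourier_L2_def)
qed

context real_distribution
begin

text \<open>The centred CDF at \<open>x\<close> is the expectation over \<open>y\<close> of \<open>1{y \<le> x} - 1{0 \<le> x}\<close>, so by Fubini only
  differences of step functions have to be transformed; no integrability of the CDF itself is needed.\<close>

lemma fourier_L1_truncated_centre_cdf:
  assumes "\<omega> \<noteq> 0"
  shows "fourier_L1 (\<lambda>x. complex_of_real (truncated n (centre (cdf M)) x)) \<omega> =
    complex_of_real (1 / sqrt (2 * pi)) * (\<i> / complex_of_real \<omega>) *
      (CLINT y|M. 1 - exp (- (\<i> * complex_of_real \<omega> * complex_of_real (max (- real n) (min (real n) y)))))"
proof -
  interpret P: pair_sigma_finite lborel M
    by (intro pair_sigma_finite.intro sigma_finite_lborel) unfold_locales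
  let ?e = "\<lambda>x. exp (- (\<i> * complex_of_real \<omega> * complex_of_real x))"
  let ?K = "\<lambda>x y. indicator {- real n..real n} x * complex_of_real (indicator {y..} x - indicator {0..} x) * ?e x"
  have Km[measurable]: "(\<lambda>(x, y). ?K x y) \<in> borel_measurable (lborel \<Otimes>\<^sub>M M)"
  proof -
    have [measurable]: "fst \<in> borel_measurable (lborel \<Otimes>\<^sub>M M)" "snd \<in> borel_measurable (lborel \<Otimes>\<^sub>M M)"
      by (auto intro: measurable_fst' measurable_snd' simp: measurable_cong_sets[OF sets_pair_measure_cong[OF sets_lborel events_eq_borel] refl])
    \<comment> \<open>The moving half-line \<open>{y..}\<close> becomes an order relation between
      the two coordinates, which is jointly measurable.\<close>
    have "(\<lambda>p. ?K (fst p) (snd p)) = (\<lambda>p. indicator {- real n..real n} (fst p) *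
        complex_of_real ((if snd p \<le> fst p then 1 else 0) - indicator {0..} (fst p)) * ?e (fst p))"
      by (auto simp: indicator_def)
    also have "\<dots> \<in> borel_measurable (lborel \<Otimes>\<^sub>M M)"
      by measurable
    finally show ?thesis by (simp add: case_prod_unfold)
  qed
  have "integrable (lborel \<Otimes>\<^sub>M M) (\<lambda>(x, y). indicator {- real n..real n} x * (1::real))"
    by (rule P.integrable_product_mult) auto
  then have K: "integrable (lborel \<Otimes>\<^sub>M M) (\<lambda>(x, y). ?K x y)"
    by (rule Bochner_Integration.integrable_bound) (auto simp: norm_mult indicator_def)
  have eq: "complex_of_real (truncated n (centre (cdf M)) x) * ?e x = (CLINT y|M. ?K x y)" for x
  proof -
    have "centre (cdf M) x = (LINT y|M. indicator {..x} y - indicator {0..} x)"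
      by (subst Bochner_Integration.integral_diff) (auto simp: centre_def cdf_def2 prob_space[simplified] less_top[symmetric] intro!: integrable_real_indicator)
    also have "\<dots> = (LINT y|M. indicator {y..} x - indicator {0..} x)"
      by (intro Bochner_Integration.integral_cong) (auto simp: indicator_def)
    finally have "complex_of_real (truncated n (centre (cdf M)) x) * ?e x =
      indicator {- real n..real n} x * (CLINT y|M. complex_of_real (indicator {y..} x - indicator {0..} x)) * ?e x"
      unfolding truncated_def integral_complex_of_real by (simp add: indicator_def)
    also have "\<dots> = (CLINT y|M. ?K x y)"
      by (simp del: of_real_diff)
    finally show ?thesis .
  qed
  have "(CLBINT x. complex_of_real (truncated n (centre (cdf M)) x) * ?e x) = (CLBINT x. (CLINT y|M. ?K x y))"
    unfolding eq ..
  also have "\<dots> = (CLINT y|M. (CLBINT x. ?K x y))"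
    by (rule P.Fubini_integral[OF K, symmetric])
  also have "\<dots> = (CLINT y|M. \<i> / complex_of_real \<omega> * (1 - ?e (max (- real n) (min (real n) y))))"
    unfolding integral_step_difference[OF assms] ..
  also have "\<dots> = \<i> / complex_of_real \<omega> * (CLINT y|M. 1 - ?e (max (- real n) (min (real n) y)))"
    by (rule integral_mult_right_zero)
  finally show ?thesis
    unfolding fourier_L1_def by (simp add: mult.assoc)
qed

text \<open>What the truncated formula becomes when the clipping disappears. At frequency 0 the
  division gives 0, which is harmless on a null set.\<close>

definition centred_cdf_transform :: "real \<Rightarrow> complex" where
  "centred_cdf_transform \<omega> = complex_of_real (1 / sqrt (2 * pi)) * (\<i> / complex_of_real \<omega>) * (1 - char M (- \<omega>))"

lemma measurable_centred_cdf_transform[measurable]: "centred_cdf_transform \<in> borel_measurable borel"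
  unfolding centred_cdf_transform_def[abs_def] by measurable

text \<open>For each y the clipping is inactive as soon as n \<ge> |y|, and the integrand is bounded
  by 2, so dominated convergence over the probability measure applies.\<close>

lemma fourier_L1_truncated_tendsto:
  assumes "\<omega> \<noteq> 0"
  shows "(\<lambda>n. fourier_L1 (\<lambda>x. complex_of_real (truncated n (centre (cdf M)) x)) \<omega>) \<longlonglongrightarrow> centred_cdf_transform \<omega>"
proof -
  let ?e = "\<lambda>x. exp (- (\<i> * complex_of_real \<omega> * complex_of_real x))"
  have [simp]: "cmod (?e x) = 1" for x
    using norm_exp_i_times[of "- (\<omega> * x)"] by (simp add: mult.assoc)
  have "(\<lambda>n. CLINT y|M. 1 - ?e (max (- real n) (min (real n) y))) \<longlonglongrightarrow> (CLINT y|M. 1 - ?e y)"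
  proof (rule integral_dominated_convergence[where w="\<lambda>_. 2"])
    show "AE y in M. (\<lambda>n. 1 - ?e (max (- real n) (min (real n) y))) \<longlonglongrightarrow> 1 - ?e y"
    proof (rule AE_I2)
      fix y
      obtain N where N: "\<bar>y\<bar> \<le> real N" using real_arch_simple by blast
      have "\<forall>\<^sub>F n in sequentially. 1 - ?e (max (- real n) (min (real n) y)) = 1 - ?e y"
        using eventually_ge_at_top[of N]
      proof eventually_elim
        case (elim n)
        then have "max (- real n) (min (real n) y) = y" using N by linarith
        then show ?case by simp
      qed
      then show "(\<lambda>n. 1 - ?e (max (- real n) (min (real n) y))) \<longlonglongrightarrow> 1 - ?e y"
        by (rule tendsto_eventually)
    qed
    show "AE y in M. cmod (1 - ?e (max (- real n) (min (real n) y))) \<le> 2" for n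
      by (intro AE_I2 order_trans[OF norm_triangle_ineq4]) simp
  qed auto
  also have "(CLINT y|M. 1 - ?e y) = 1 - char M (- \<omega>)"
  proof -
    have "integrable M ?e"
      by (rule integrable_const_bound[of _ 1]) auto
    then show ?thesis
      unfolding char_def by (subst Bochner_Integration.integral_diff) (auto simp: prob_space[simplified] mult.assoc)
  qed
  finally show ?thesis
    unfolding fourier_L1_truncated_centre_cdf[OF assms] centred_cdf_transform_def by (intro tendsto_mult_left)
qed

lemma integrable_truncated_centre_cdf: "integrable lborel (truncated n (centre (cdf M)))"
proof (rule Bochner_Integration.integrable_bound)
  show "integrable lborel (\<lambda>x. indicator {- real n..real n} x * (2::real))"
    by (intro integrable_mult_left) auto
  have "\<bar>centre (cdf M) x\<bar> \<le> 2" for x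
    using cdf_nonneg[of x] cdf_bounded_prob[of x] by (auto simp: centre_def indicator_def)
  then show "AE x in lborel. norm (truncated n (centre (cdf M)) x) \<le> norm (indicator {- real n..real n} x * (2::real))"
    by (auto simp: truncated_def indicator_def)
qed (use borel_measurable_cdf in measurable)

text \<open>This places the transform of a finite-energy CDF in \<open>H_cdf\<close>, whose weight
  is at most one.\<close>

lemma nn_integral_centred_cdf_transform_le:
  "(\<integral>\<^sup>+\<omega>. ennreal ((cmod (centred_cdf_transform \<omega>))\<^sup>2) \<partial>lborel) \<le> centred_energy (cdf M)"
  unfolding centred_energy_def
  by (rule nn_integral_fourier_limit_le[OF _ integrable_truncated_centre_cdf fourier_L1_truncated_tendsto])
     (auto intro!: always_eventually nn_integral_mono ennreal_leI simp: truncated_def indicator_def)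

text \<open>With n fixed and m \<ge> n, the difference of the truncations at m and n has energy at
  most that of the tail beyond n. Letting m grow bounds the distance of the closed form to the n-th
  truncated transform by this tail, which vanishes because the energy is finite.\<close>

lemma centred_cdf_transform_in_fourier_L2:
  assumes fin: "centred_energy (cdf M) < \<infinity>"
  shows "centred_cdf_transform \<in> fourier_L2 (\<lambda>x. complex_of_real (centre (cdf M) x))"
proof -
  note [measurable] = borel_measurable_cdf
  let ?f = "centre (cdf M)" and ?g = centred_cdf_transform
  let ?t = "\<lambda>n x. ennreal ((?f x - truncated n ?f x)\<^sup>2)"
  let ?D = "\<lambda>n. \<integral>\<^sup>+\<omega>. ennreal ((cmod (?g \<omega> - fourier_L1 (\<lambda>x. complex_of_real (truncated n ?f x)) \<omega>))\<^sup>2) \<partial>lborel"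
  have le: "?D n \<le> (\<integral>\<^sup>+x. ?t n x \<partial>lborel)" for n
  proof (rule nn_integral_fourier_limit_le)
    show "integrable lborel (\<lambda>x. truncated m ?f x - truncated n ?f x)" for m
      by (intro Bochner_Integration.integrable_diff integrable_truncated_centre_cdf)
    show "(\<lambda>m. fourier_L1 (\<lambda>x. complex_of_real (truncated m ?f x - truncated n ?f x)) \<omega>) \<longlonglongrightarrow>
       ?g \<omega> - fourier_L1 (\<lambda>x. complex_of_real (truncated n ?f x)) \<omega>" if "\<omega> \<noteq> 0" for \<omega>
      unfolding fourier_L1_diff[OF integrable_truncated_centre_cdf integrable_truncated_centre_cdf]
      by (intro tendsto_diff fourier_L1_truncated_tendsto that tendsto_const)
    show "\<forall>\<^sub>F m in sequentially. (\<integral>\<^sup>+x. ennreal ((truncated m ?f x - truncated n ?f x)\<^sup>2) \<partial>lborel)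
        \<le> (\<integral>\<^sup>+x. ?t n x \<partial>lborel)"
      using eventually_ge_at_top[of n]
    proof eventually_elim
      case (elim m)
      then show ?case
        by (intro nn_integral_mono ennreal_leI) (auto simp: truncated_def indicator_def)
    qed
  qed measurable
  have "(\<lambda>n. \<integral>\<^sup>+x. ?t n x \<partial>lborel) \<longlonglongrightarrow> (\<integral>\<^sup>+x. 0 \<partial>(lborel :: real measure))"
  proof (rule nn_integral_dominated_convergence[where w="\<lambda>x. ennreal ((?f x)\<^sup>2)"])
    show "AE x in lborel. ?t n x \<le> ennreal ((?f x)\<^sup>2)" for n
      by (auto intro!: ennreal_leI simp: truncated_def indicator_def)
    show "AE x in lborel. (\<lambda>n. ?t n x) \<longlonglongrightarrow> 0"
    proof (rule AE_I2)
      fix x :: real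
      obtain N where N: "\<bar>x\<bar> \<le> real N" using real_arch_simple by blast
      have "\<forall>\<^sub>F n in sequentially. ?t n x = 0"
        using eventually_ge_at_top[of N]
      proof eventually_elim
        case (elim n)
        then have "x \<in> {- real n..real n}" using N by (auto simp: abs_le_iff)
        then show ?case by (simp add: truncated_def)
      qed
      then show "(\<lambda>n. ?t n x) \<longlonglongrightarrow> 0" by (rule tendsto_eventually)
    qed
  qed (use fin in \<open>simp_all add: centred_energy_def\<close>)
  then have tail: "(\<lambda>n. \<integral>\<^sup>+x. ?t n x \<partial>lborel) \<longlonglongrightarrow> 0" by simp
  have "?D \<longlonglongrightarrow> 0"
    by (rule tendsto_sandwich[OF _ _ tendsto_const tail]) (intro always_eventually allI zero_le le)+
  then show ?thesis
    unfolding fourier_L2_of_real by simp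
qed

end

text \<open>On \<open>Gamma_F\<close> the transport is the class of the explicit function
  \<open>U_mult centred_cdf_transform\<close>. Away from frequency 0 its factor \<omega> cancels, so
  it determines the characteristic function almost everywhere, by continuity everywhere, and Levy's
  uniqueness theorem recovers the CDF.\<close>

lemma V_op_inj_on_Gamma_F:
  assumes "0 < \<epsilon>"
  shows "inj_on (V_op \<epsilon>) Gamma_F"
proof (rule inj_onI)
  have V: "V_op \<epsilon> (cdf \<mu>) = ae_class (U_mult (real_distribution.centred_cdf_transform \<mu>))"
    if "real_distribution \<mu>" "centred_energy (cdf \<mu>) < \<infinity>" for \<mu>
  proof -
    interpret real_distribution \<mu> by fact
    note [measurable] = borel_measurable_cdf
    have F: "fourier_L2 (\<lambda>x. complex_of_real (centre (cdf \<mu>) x)) = ae_class centred_cdf_transform"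
      by (rule fourier_L2_eq_ae_class[OF centred_cdf_transform_in_fourier_L2[OF that(2)]]) measurable
    \<comment> \<open>\<open>U_op\<close> is restricted to \<open>H_cdf\<close> and takes one common
      default value elsewhere, so membership must be checked before it can be evaluated.\<close>
    have "(\<integral>\<^sup>+\<omega>. ennreal (\<omega>\<^sup>2 / (\<omega>\<^sup>2 + \<epsilon>) * (cmod (centred_cdf_transform \<omega>))\<^sup>2) \<partial>lborel)
        \<le> (\<integral>\<^sup>+\<omega>. ennreal ((cmod (centred_cdf_transform \<omega>))\<^sup>2) \<partial>lborel)"
      using assms by (intro nn_integral_mono ennreal_leI mult_left_le_one_le) (auto simp: divide_le_eq_1 add_nonneg_pos)
    also have "\<dots> < \<infinity>"
      using nn_integral_centred_cdf_transform_le that(2) by (rule le_less_trans)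
    finally have "ae_class centred_cdf_transform \<in> H_cdf \<epsilon>"
      unfolding H_cdf_def by auto
    then show ?thesis
      unfolding V_op_def F by (intro U_op_ae_class) measurable
  qed
  fix F G assume "F \<in> Gamma_F" "G \<in> Gamma_F" and eq: "V_op \<epsilon> F = V_op \<epsilon> G"
  then obtain \<mu> \<nu> where \<mu>: "real_distribution \<mu>" "F = cdf \<mu>" and \<nu>: "real_distribution \<nu>" "G = cdf \<nu>"
    and fin: "centred_energy F < \<infinity>" "centred_energy G < \<infinity>"
    by (auto simp: Gamma_F_def)
  interpret \<mu>: real_distribution \<mu> by fact
  interpret \<nu>: real_distribution \<nu> by fact
  have "ae_class (U_mult \<mu>.centred_cdf_transform) = ae_class (U_mult \<nu>.centred_cdf_transform)"
    using eq fin V[OF \<mu>(1)] V[OF \<nu>(1)] by (simp add: \<mu>(2) \<nu>(2))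
  moreover have "U_mult \<mu>.centred_cdf_transform \<in> ae_class (U_mult \<mu>.centred_cdf_transform)"
    by (simp add: ae_class_def U_mult_measurable)
  ultimately have "AE \<omega> in lborel. U_mult \<mu>.centred_cdf_transform \<omega> = U_mult \<nu>.centred_cdf_transform \<omega>"
    by (simp add: ae_class_def)
  then have "AE \<omega> in lborel. char \<mu> (- \<omega>) = char \<nu> (- \<omega>)"
    using AE_lborel_singleton[of 0]
    by eventually_elim (simp add: U_mult_def \<mu>.centred_cdf_transform_def \<nu>.centred_cdf_transform_def)
  then have "(\<lambda>\<omega>. char \<mu> (- \<omega>)) = (\<lambda>\<omega>. char \<nu> (- \<omega>))"
    by (rule AE_lborel_continuous_eq)
       (auto intro!: isCont_o2[where g="char \<mu>"] isCont_o2[where g="char \<nu>"] \<mu>.isCont_char \<nu>.isCont_char continuous_intros)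
  then have "char \<mu> = char \<nu>"
    by (metis (no_types) ext minus_minus)
  then show "F = G"
    using Levy_uniqueness[OF \<mu>(1) \<nu>(1)] by (simp add: \<mu>(2) \<nu>(2))
qed

section \<open>CDF fields\<close>

text \<open>Rounding the real argument up to a grid leaves countably many measurable sections to
  glue, and right continuity removes the rounding in the limit. The maps \<open>k\<close> and
  \<open>g\<close> are arbitrary so that the lemma applies to a next pair and to the argument at
  which the Bellman operator reads the field.\<close>

lemma measurable_right_continuous_field:
  fixes F :: "'p \<Rightarrow> real \<Rightarrow> real"
  assumes F: "\<And>y. (\<lambda>p. F p y) \<in> borel_measurable S"
    and cont: "\<And>p y. p \<in> space S \<Longrightarrow> continuous (at_right y) (F p)"
    and k[measurable]: "k \<in> N \<rightarrow>\<^sub>M S" and g[measurable]: "g \<in> borel_measurable N"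
  shows "(\<lambda>z. F (k z) (g z)) \<in> borel_measurable N"
proof (rule borel_measurable_LIMSEQ_real)
  \<comment> \<open>the least point of the grid \<open>\<int> / (n + 1)\<close> strictly to the right of \<open>y\<close>\<close>
  define d where "d n y = (real_of_int \<lfloor>real (Suc n) * y\<rfloor> + 1) / real (Suc n)" for n y
  show "(\<lambda>z. F (k z) (d n (g z))) \<in> borel_measurable N" for n
  proof -
    have "(\<lambda>z. F (k z) ((real_of_int i + 1) / real (Suc n))) \<in> borel_measurable N" for i
      by (rule measurable_compose[OF k F])
    then have "(\<lambda>z. F (k z) ((real_of_int \<lfloor>real (Suc n) * g z\<rfloor> + 1) / real (Suc n))) \<in> borel_measurable N"
      by (rule measurable_compose_countable) measurable
    then show ?thesis by (simp add: d_def)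
  qed
  fix z assume z: "z \<in> space N"
  then have "k z \<in> space S" by (rule measurable_space[OF k])
  then have lim: "(F (k z) \<longlongrightarrow> F (k z) (g z)) (at_right (g z))"
    using cont by (simp add: continuous_within)
  \<comment> \<open>Strictness matters: the filter \<open>at_right\<close> excludes the point
    itself.\<close>
  have gt: "g z < d n (g z)" for n
    unfolding d_def by (subst pos_less_divide_eq) (simp_all add: mult.commute floor_correct[THEN conjunct2])
  have le: "d n (g z) \<le> g z + inverse (real (Suc n))" for n
    unfolding d_def by (subst pos_divide_le_eq) (simp_all add: field_simps del: of_nat_Suc)
  have "(\<lambda>n. d n (g z)) \<longlonglongrightarrow> g z"
  proof (rule tendsto_sandwich[OF _ _ tendsto_const])
    show "(\<lambda>n. g z + inverse (real (Suc n))) \<longlonglongrightarrow> g z"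
      using tendsto_add[OF tendsto_const LIMSEQ_inverse_real_of_nat, of "g z"] by simp
    show "\<forall>\<^sub>F n in sequentially. g z \<le> d n (g z)"
      by (intro always_eventually allI less_imp_le gt)
    show "\<forall>\<^sub>F n in sequentially. d n (g z) \<le> g z + inverse (real (Suc n))"
      by (intro always_eventually allI le)
  qed
  then have "filterlim (\<lambda>n. d n (g z)) (at_right (g z)) sequentially"
    by (simp add: filterlim_at gt less_imp_neq[OF gt, symmetric])
  then show "(\<lambda>n. F (k z) (d n (g z))) \<longlonglongrightarrow> F (k z) (g z)"
    by (rule filterlim_compose[OF lim])
qed

lemma Gamma_F_D:
  assumes "F \<in> Gamma_F"
  shows Gamma_F_mono: "x \<le> y \<Longrightarrow> F x \<le> F y"
    and Gamma_F_nonneg: "0 \<le> F x"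
    and Gamma_F_le_1: "F x \<le> 1"
    and Gamma_F_continuous: "continuous (at_right x) F"
    and Gamma_F_at_top: "(F \<longlongrightarrow> 1) at_top"
    and Gamma_F_at_bot: "(F \<longlongrightarrow> 0) at_bot"
    and Gamma_F_measurable: "F \<in> borel_measurable borel"
proof -
  from assms obtain \<mu> where \<mu>: "real_distribution \<mu>" and F: "F = cdf \<mu>"
    by (auto simp: Gamma_F_def)
  interpret real_distribution \<mu> by fact
  show "x \<le> y \<Longrightarrow> F x \<le> F y" "0 \<le> F x" "F x \<le> 1" "continuous (at_right x) F"
    "(F \<longlongrightarrow> 1) at_top" "(F \<longlongrightarrow> 0) at_bot" "F \<in> borel_measurable borel"
    unfolding F by (auto intro: cdf_nondecreasing cdf_nonneg cdf_bounded_prob cdf_is_right_cont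
       cdf_lim_at_top_prob cdf_lim_at_bot borel_measurable_cdf)
qed

lemma nn_integral_sq_add_le:
  fixes f g :: "real \<Rightarrow> real"
  assumes [measurable]: "f \<in> borel_measurable borel" "g \<in> borel_measurable borel"
  shows "(\<integral>\<^sup>+x. ennreal ((f x + g x)\<^sup>2) \<partial>lborel) \<le>
    2 * (\<integral>\<^sup>+x. ennreal ((f x)\<^sup>2) \<partial>lborel) + 2 * (\<integral>\<^sup>+x. ennreal ((g x)\<^sup>2) \<partial>lborel)"
proof -
  have "(\<integral>\<^sup>+x. ennreal ((f x + g x)\<^sup>2) \<partial>lborel) \<le> (\<integral>\<^sup>+x. 2 * ennreal ((f x)\<^sup>2) + 2 * ennreal ((g x)\<^sup>2) \<partial>lborel)"
  proof (rule nn_integral_mono)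
    fix x
    have "ennreal ((f x + g x)\<^sup>2) \<le> ennreal (2 * (f x)\<^sup>2 + 2 * (g x)\<^sup>2)"
      using sum_squares_bound[of "f x" "g x"] by (intro ennreal_leI) (simp add: power2_sum)
    then show "ennreal ((f x + g x)\<^sup>2) \<le> 2 * ennreal ((f x)\<^sup>2) + 2 * ennreal ((g x)\<^sup>2)"
      by (simp add: ennreal_mult)
  qed
  also have "\<dots> = 2 * (\<integral>\<^sup>+x. ennreal ((f x)\<^sup>2) \<partial>lborel) + 2 * (\<integral>\<^sup>+x. ennreal ((g x)\<^sup>2) \<partial>lborel)"
    by (simp add: nn_integral_add nn_integral_cmult)
  finally show ?thesis .
qed

text \<open>Jensen's inequality for the square, as nonnegativity of the variance; the bound by 1
  supplies both integrabilities.\<close>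

lemma (in prob_space) expectation_sq_le:
  fixes u :: "'a \<Rightarrow> real"
  assumes [measurable]: "u \<in> borel_measurable M" and "\<And>x. x \<in> space M \<Longrightarrow> \<bar>u x\<bar> \<le> 1"
  shows "ennreal ((expectation u)\<^sup>2) \<le> (\<integral>\<^sup>+x. ennreal ((u x)\<^sup>2) \<partial>M)"
proof -
  have i: "integrable M u" "integrable M (\<lambda>x. (u x)\<^sup>2)"
    by (rule integrable_const_bound[of _ 1]; use assms(2) in \<open>auto simp: abs_square_le_1\<close>)+
  have "(expectation u)\<^sup>2 \<le> expectation (\<lambda>x. (u x)\<^sup>2)"
    using variance_eq[OF i] variance_positive[of u] by simp
  then have "ennreal ((expectation u)\<^sup>2) \<le> ennreal (expectation (\<lambda>x. (u x)\<^sup>2))"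
    by (rule ennreal_leI)
  also have "\<dots> = (\<integral>\<^sup>+x. ennreal ((u x)\<^sup>2) \<partial>M)"
    by (rule nn_integral_eq_integral[symmetric, OF i(2)]) simp
  finally show ?thesis .
qed

text \<open>CDFs that agree almost everywhere have the same transport, and the transport is injective.\<close>

lemma Gamma_F_eqI:
  assumes F: "F \<in> Gamma_F" and G: "G \<in> Gamma_F" and "AE x in lborel. F x = G x"
  shows "F = G"
\<comment> \<open>The value 1 for \<epsilon> is arbitrary; any positive weight parameter would
  serve.\<close>
proof (rule inj_onD[OF V_op_inj_on_Gamma_F[of 1] _ F G])
  have [measurable]: "F \<in> borel_measurable borel" "G \<in> borel_measurable borel"
    by (rule Gamma_F_measurable[OF F] Gamma_F_measurable[OF G])+
  have "fourier_L2 (\<lambda>x. complex_of_real (centre F x)) = fourier_L2 (\<lambda>x. complex_of_real (centre G x))"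
    by (rule fourier_L2_cong_AE) (use assms(3) in \<open>auto simp: centre_def\<close>)
  then show "V_op 1 F = V_op 1 G"
    by (simp add: V_op_def)
qed simp

lemma X_cdf_D:
  assumes "F \<in> X_cdf M"
  shows X_cdf_Gamma_F: "q \<in> space (state_actions M) \<Longrightarrow> F q \<in> Gamma_F"
    and X_cdf_measurable: "(\<lambda>q. F q x) \<in> borel_measurable (state_actions M)"
    and X_cdf_energy: "(SUP q\<in>space (state_actions M). centred_energy (F q)) < \<infinity>"
    and X_cdf_extensional: "F \<in> extensional (space (state_actions M))"
  using assms unfolding X_cdf_def by (auto simp: PiE_iff)

lemma X_cdf_compose_measurable:
  assumes F: "F \<in> X_cdf M" and "k \<in> N \<rightarrow>\<^sub>M state_actions M" "g \<in> borel_measurable N"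
  shows "(\<lambda>z. F (k z) (g z)) \<in> borel_measurable N"
  by (rule measurable_right_continuous_field[OF X_cdf_measurable[OF F] Gamma_F_continuous[OF X_cdf_Gamma_F[OF F]] assms(2,3)])

lemma inj_on_V_field:
  assumes "0 < \<epsilon>"
  shows "inj_on (V_field M \<epsilon>) (X_cdf M)"
proof (rule inj_onI)
  fix F G assume F: "F \<in> X_cdf M" and G: "G \<in> X_cdf M" and eq: "V_field M \<epsilon> F = V_field M \<epsilon> G"
  have "F q = G q" if q: "q \<in> space (state_actions M)" for q
  proof (rule inj_onD[OF V_op_inj_on_Gamma_F[OF assms]])
    show "V_op \<epsilon> (F q) = V_op \<epsilon> (G q)"
      using fun_cong[OF eq, of q] q by (simp add: V_field_def)
  qed (rule X_cdf_Gamma_F[OF F q] X_cdf_Gamma_F[OF G q])+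
  then show "F = G"
    by (rule extensionalityI[OF X_cdf_extensional[OF F] X_cdf_extensional[OF G]])
qed

section \<open>The Markov property of trajectories\<close>

abbreviation path_space :: "('s, 'a) mdp \<Rightarrow> (nat \<Rightarrow> 's \<times> 'a) measure" where
  "path_space M \<equiv> PiM UNIV (\<lambda>_. state_actions M)"

lemma measurable_step_reward:
  assumes "discounted_mdp M"
    and [measurable]: "f \<in> N \<rightarrow>\<^sub>M state_actions M" "g \<in> N \<rightarrow>\<^sub>M state_actions M"
  shows "(\<lambda>x. step_reward M (f x) (g x)) \<in> borel_measurable N"
proof -
  have [measurable]: "reward M \<in> borel_measurable (states M \<Otimes>\<^sub>M actions M \<Otimes>\<^sub>M states M)"
    using assms(1) by (simp add: discounted_mdp_def)
  have "step_reward M p q = reward M (fst p, snd p, fst q)" for p q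
    by (cases p; cases q) simp
  then show ?thesis by simp
qed

lemma measurable_log_policy:
  assumes "stationary_policy M \<pi>" and [measurable]: "f \<in> N \<rightarrow>\<^sub>M state_actions M"
  shows "(\<lambda>x. log_policy \<pi> (f x)) \<in> borel_measurable N"
proof -
  have [measurable]: "act_density \<pi> \<in> borel_measurable (state_actions M)"
    using assms(1) by (simp add: stationary_policy_def)
  show ?thesis unfolding log_policy_def by measurable
qed

text \<open>Cylinders become products over an initial segment of times, with the whole space at
  unconstrained ones, so that they can be treated by induction on the length.\<close>

lemma indicator_prod_emb_cylinder:
  fixes \<omega> :: "nat \<Rightarrow> 'a"
  assumes "J \<subseteq> {..<n}" and "\<omega> \<in> space (PiM UNIV (\<lambda>_. S))"
  shows "indicator (prod_emb UNIV (\<lambda>_. S) J (Pi\<^sub>E J E)) \<omega> =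
    (\<Prod>i<n. indicator (if i \<in> J then E i else space S) (\<omega> i) :: ennreal)"
proof (cases "\<omega> \<in> prod_emb UNIV (\<lambda>_. S) J (Pi\<^sub>E J E)")
  case True
  then have "\<omega> i \<in> E i" if "i \<in> J" for i
    using that by (auto simp: prod_emb_iff)
  moreover have "\<omega> i \<in> space S" for i
    using assms(2) by (auto simp: space_PiM)
  ultimately have "(\<Prod>i<n. indicator (if i \<in> J then E i else space S) (\<omega> i) :: ennreal) = 1"
    by (intro prod.neutral) auto
  then show ?thesis using True by simp
next
  case False
  with assms(2) obtain i where i: "i \<in> J" "\<omega> i \<notin> E i"
    by (auto simp: prod_emb_iff space_PiM)
  then have "(\<Prod>i<n. indicator (if i \<in> J then E i else space S) (\<omega> i) :: ennreal) = 0"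
    using assms(1) by (intro prod_zero bexI[of _ i]) auto
  then show ?thesis using False by simp
qed

locale policy_mdp =
  fixes M :: "('s, 'a) mdp" and \<pi> :: "('s, 'a) policy"
  assumes mdp: "discounted_mdp M" and policy: "stationary_policy M \<pi>"
begin

abbreviation S where "S \<equiv> state_actions M"
abbreviation K where "K \<equiv> next_pair M \<pi>"
abbreviation Path where "Path \<equiv> path_space M"
abbreviation traj where "traj \<equiv> trajectory M \<pi>"

lemmas [measurable (raw)] = measurable_step_reward[OF mdp] measurable_log_policy[OF policy]

lemma K_measurable[measurable]: "K \<in> S \<rightarrow>\<^sub>M prob_algebra S"
  by (rule measurable_next_pair[OF mdp policy])

lemma K_subprob[measurable]: "K \<in> S \<rightarrow>\<^sub>M subprob_algebra S"
  by (rule measurable_prob_algebraD) measurable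

lemma K_nn_integral_measurable[measurable]:
  "h \<in> borel_measurable S \<Longrightarrow> (\<lambda>q. \<integral>\<^sup>+x. h x \<partial>K q) \<in> borel_measurable S"
  by (rule measurable_compose[OF K_subprob nn_integral_measurable_subprob_algebra])

lemma prob_space_K: "q \<in> space S \<Longrightarrow> prob_space (K q)"
  and sets_K: "q \<in> space S \<Longrightarrow> sets (K q) = sets S"
  using measurable_space[OF K_measurable, of q] by (auto simp: space_prob_algebra)

lemma space_K: "q \<in> space S \<Longrightarrow> space (K q) = space S"
  by (rule sets_eq_imp_space_eq[OF sets_K])

text \<open>The limit measure is accessed only through its marginals: the first n coordinates follow
  the n-fold composition of the kernels.\<close>

lemma trajectory_facts:
  assumes "sa \<in> space S"
  shows sets_trajectory: "sets (traj sa) = sets Path"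
    and prob_space_trajectory: "prob_space (traj sa)"
    and nn_integral_trajectory_restrict: "f \<in> borel_measurable (PiM {0..<n} (\<lambda>_. S)) \<Longrightarrow>
      (\<integral>\<^sup>+\<omega>. f (restrict \<omega> {0..<n}) \<partial>traj sa) =
      (\<integral>\<^sup>+x. f x \<partial>Ionescu_Tulcea.C (traj_kernel M \<pi> sa) (\<lambda>_. S) 0 n (\<lambda>_. undefined))"
proof -
  interpret IT: Ionescu_Tulcea "traj_kernel M \<pi> sa" "\<lambda>_. S"
    by (rule Ionescu_Tulcea_traj_kernel[OF mdp policy assms])
  have T: "traj sa = IT.PF.lim" unfolding trajectory_def ..
  show s: "sets (traj sa) = sets Path" unfolding T by simp
  \<comment> \<open>The total mass is read off the cylinder over the empty index set, which is the
    whole space.\<close>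
  have "emeasure IT.PF.lim (space IT.PF.lim) = 1"
  proof -
    have "emeasure IT.PF.lim (IT.PF.emb UNIV {} (space (PiM {} (\<lambda>_. S)))) = emeasure (IT.CI {}) (space (PiM {} (\<lambda>_. S)))"
      by (rule IT.lim) auto
    also have "\<dots> = emeasure (IT.CI {}) (space (IT.CI {}))"
      by (subst IT.PF.space_P) auto
    also have "\<dots> = 1"
      by (intro prob_space.emeasure_space_1 IT.PF.prob_space_P) auto
    finally show ?thesis by (simp add: prod_emb_def space_PiM restrict_def vimage_def)
  qed
  then show "prob_space (traj sa)" unfolding T by (rule prob_spaceI)
  assume f: "f \<in> borel_measurable (PiM {0..<n} (\<lambda>_. S))"
  have "(\<integral>\<^sup>+\<omega>. f (restrict \<omega> {0..<n}) \<partial>traj sa) = (\<integral>\<^sup>+x. f x \<partial>distr (traj sa) (PiM {0..<n} (\<lambda>_. S)) (\<lambda>\<omega>. restrict \<omega> {0..<n}))"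
    using f by (intro nn_integral_distr[symmetric]) (simp_all add: measurable_cong_sets[OF s refl] measurable_restrict_subset del: restrict_apply)
  also have "distr (traj sa) (PiM {0..<n} (\<lambda>_. S)) (\<lambda>\<omega>. restrict \<omega> {0..<n}) = IT.CI {0..<n}"
    unfolding T by (rule IT.distr_lim) simp
  also have "IT.CI {0..<n} = IT.C 0 n (\<lambda>_. undefined)"
  proof (rule measure_eqI)
    show "sets (IT.CI {0..<n}) = sets (IT.C 0 n (\<lambda>_. undefined))"
      by (subst IT.sets_C) (auto simp: IT.PF.sets_P)
    fix X assume "X \<in> sets (IT.CI {0..<n})"
    then have X: "X \<in> sets (PiM {0..<n} (\<lambda>_. S))" by (simp add: IT.PF.sets_P)
    show "emeasure (IT.CI {0..<n}) X = emeasure (IT.C 0 n (\<lambda>_. undefined)) X"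
      by (subst IT.emeasure_CI[OF subset_refl X]) (simp add: prod_emb_id[OF sets.sets_into_space[OF X, unfolded space_PiM]])
  qed
  finally show "(\<integral>\<^sup>+\<omega>. f (restrict \<omega> {0..<n}) \<partial>traj sa) = (\<integral>\<^sup>+x. f x \<partial>IT.C 0 n (\<lambda>_. undefined))" .
qed

section \<open>Integrating out one coordinate at a time\<close>

lemma trajectory_initial:
  assumes sa: "sa \<in> space S" and h[measurable]: "h \<in> borel_measurable S"
  shows "(\<integral>\<^sup>+\<omega>. h (\<omega> 0) \<partial>traj sa) = h sa"
proof -
  interpret IT: Ionescu_Tulcea "traj_kernel M \<pi> sa" "\<lambda>_. S"
    by (rule Ionescu_Tulcea_traj_kernel[OF mdp policy sa])
  have u: "(\<lambda>_. undefined) \<in> space (PiM {0..<0::nat} (\<lambda>_. S))" by simp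
  have m: "(\<lambda>x. h (x 0)) \<in> borel_measurable (PiM {0..<Suc 0} (\<lambda>_. S))"
    by measurable
  have "(\<integral>\<^sup>+\<omega>. h (\<omega> 0) \<partial>traj sa) = (\<integral>\<^sup>+\<omega>. h (restrict \<omega> {0..<Suc 0} 0) \<partial>traj sa)"
    by simp
  also have "\<dots> = (\<integral>\<^sup>+x. h (x 0) \<partial>IT.C 0 (Suc 0) (\<lambda>_. undefined))"
    by (rule nn_integral_trajectory_restrict[OF sa m])
  also have "IT.C 0 (Suc 0) (\<lambda>_. undefined) = IT.eP 0 (\<lambda>_. undefined)"
    unfolding IT.C.simps add_0 by (rule bind_return[OF IT.measurable_eP u])
  also have "(\<integral>\<^sup>+x. h (x 0) \<partial>IT.eP 0 (\<lambda>_. undefined)) = (\<integral>\<^sup>+q. h q \<partial>traj_kernel M \<pi> sa 0 (\<lambda>_. undefined))"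
    using IT.nn_integral_eP[OF u m] by simp
  also have "\<dots> = h sa"
    unfolding traj_kernel_def using sa by (simp add: nn_integral_return)
  finally show ?thesis .
qed

text \<open>The last kernel sees only coordinate n of the past, so integrating it out leaves a
  function of that coordinate. The factor for \<open>A n\<close> is grouped with this function, so
  the right-hand side has the shape of the left one with one step fewer, ready for induction over
  arbitrary \<open>h\<close>.\<close>

lemma trajectory_step:
  assumes sa: "sa \<in> space S" and h[measurable]: "h \<in> borel_measurable S"
    and A[measurable]: "\<And>i. A i \<in> sets S"
  shows "(\<integral>\<^sup>+\<omega>. (\<Prod>i<Suc n. indicator (A i) (\<omega> i)) * h (\<omega> (Suc n)) \<partial>traj sa) =
    (\<integral>\<^sup>+\<omega>. (\<Prod>i<n. indicator (A i) (\<omega> i)) * (indicator (A n) (\<omega> n) * (\<integral>\<^sup>+q. h q \<partial>K (\<omega> n))) \<partial>traj sa)"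
proof -
  interpret IT: Ionescu_Tulcea "traj_kernel M \<pi> sa" "\<lambda>_. S"
    by (rule Ionescu_Tulcea_traj_kernel[OF mdp policy sa])
  let ?u = "\<lambda>_. undefined"
  have u: "?u \<in> space (PiM {0..<0::nat} (\<lambda>_. S))" by simp
  let ?g = "\<lambda>\<omega>. \<Prod>i<Suc n. indicator (A i) (\<omega> i) :: ennreal"
  let ?P = "\<lambda>k. PiM {0..<k} (\<lambda>_. S)"
  have m1: "(\<lambda>x. ?g x * h (x (Suc n))) \<in> borel_measurable (?P (Suc (Suc n)))"
    by measurable
  have m2: "(\<lambda>x. ?g x * (\<integral>\<^sup>+q. h q \<partial>K (x n))) \<in> borel_measurable (?P (Suc n))"
    by measurable
  have "(\<integral>\<^sup>+\<omega>. ?g \<omega> * h (\<omega> (Suc n)) \<partial>traj sa) =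
      (\<integral>\<^sup>+\<omega>. ?g (restrict \<omega> {0..<Suc (Suc n)}) * h (restrict \<omega> {0..<Suc (Suc n)} (Suc n)) \<partial>traj sa)"
    by (intro nn_integral_cong arg_cong2[where f="(*)"] prod.cong) auto
  also have "\<dots> = (\<integral>\<^sup>+x. ?g x * h (x (Suc n)) \<partial>IT.C 0 (Suc (Suc n)) ?u)"
    by (rule nn_integral_trajectory_restrict[OF sa m1])
  also have "\<dots> = (\<integral>\<^sup>+x. \<integral>\<^sup>+y. ?g y * h (y (Suc n)) \<partial>IT.eP (Suc n) x \<partial>IT.C 0 (Suc n) ?u)"
    unfolding IT.C.simps(2)[of 0 "Suc n"] add_0
    by (rule nn_integral_bind[OF m1])
       (use IT.measurable_eP[of "Suc n"] in \<open>simp add: measurable_cong_sets[OF IT.sets_C[OF u] refl] del: IT.C.simps\<close>)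
  also have "\<dots> = (\<integral>\<^sup>+x. ?g x * (\<integral>\<^sup>+q. h q \<partial>K (x n)) \<partial>IT.C 0 (Suc n) ?u)"
  proof (rule nn_integral_cong)
    fix x assume "x \<in> space (IT.C 0 (Suc n) ?u)"
    then have x: "x \<in> space (?P (Suc n))" using IT.space_C[OF u, of "Suc n"] by simp
    then have xn: "x n \<in> space S" by (auto simp: space_PiM PiE_iff)
    have "(\<integral>\<^sup>+y. ?g y * h (y (Suc n)) \<partial>IT.eP (Suc n) x) =
       (\<integral>\<^sup>+q. ?g (x(Suc n := q)) * h ((x(Suc n := q)) (Suc n)) \<partial>traj_kernel M \<pi> sa (Suc n) x)"
      by (rule IT.nn_integral_eP[OF x m1])
    also have "\<dots> = (\<integral>\<^sup>+q. ?g x * h q \<partial>K (x n))"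
      unfolding traj_kernel_def nat.case
      by (intro nn_integral_cong arg_cong2[where f="(*)"] prod.cong) auto
    also have "\<dots> = ?g x * (\<integral>\<^sup>+q. h q \<partial>K (x n))"
      by (rule nn_integral_cmult) (simp add: measurable_cong_sets[OF sets_K[OF xn] refl])
    finally show "(\<integral>\<^sup>+y. ?g y * h (y (Suc n)) \<partial>IT.eP (Suc n) x) = ?g x * (\<integral>\<^sup>+q. h q \<partial>K (x n))" .
  qed
  also have "\<dots> = (\<integral>\<^sup>+\<omega>. ?g (restrict \<omega> {0..<Suc n}) * (\<integral>\<^sup>+q. h q \<partial>K (restrict \<omega> {0..<Suc n} n)) \<partial>traj sa)"
    by (rule nn_integral_trajectory_restrict[OF sa m2, symmetric])
  also have "\<dots> = (\<integral>\<^sup>+\<omega>. ?g \<omega> * (\<integral>\<^sup>+q. h q \<partial>K (\<omega> n)) \<partial>traj sa)"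
    by (intro nn_integral_cong arg_cong2[where f="(*)"] prod.cong) auto
  finally show ?thesis by (simp add: mult.assoc)
qed

text \<open>Induction from the far end: the last step is absorbed into \<open>h\<close>, until only
  the starting point remains.\<close>

lemma measurable_nn_integral_trajectory_cylinder:
  assumes "h \<in> borel_measurable S" and A[measurable]: "\<And>i. A i \<in> sets S"
  shows "(\<lambda>sa. \<integral>\<^sup>+\<omega>. (\<Prod>i<n. indicator (A i) (\<omega> i)) * h (\<omega> n) \<partial>traj sa) \<in> borel_measurable S"
  using assms(1)
proof (induction n arbitrary: h)
  case 0
  then show ?case
    by (subst measurable_cong[where g=h]) (auto simp: trajectory_initial)
next
  case (Suc n)
  note [measurable] = Suc.prems
  have "(\<lambda>q. indicator (A n) q * (\<integral>\<^sup>+x. h x \<partial>K q)) \<in> borel_measurable S" by measurable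
  from Suc.IH[OF this] show ?case
    by (simp only: measurable_cong[OF trajectory_step[OF _ Suc.prems A]])
qed

text \<open>The Markov property on cylinders. Both sides are shortened at the far end, for the path
  from \<open>sa\<close> and for the path from \<open>q\<close>, and produce the same new terminal
  function; the induction on n therefore ends at the first transition, where the claim is
  immediate.\<close>

lemma trajectory_cylinder_shift:
  assumes "h \<in> borel_measurable S" and A[measurable]: "\<And>i. A i \<in> sets S" and sa: "sa \<in> space S"
  shows "(\<integral>\<^sup>+\<omega>. (\<Prod>i<Suc n. indicator (A i) (\<omega> i)) * h (\<omega> (Suc n)) \<partial>traj sa) =
    indicator (A 0) sa * (\<integral>\<^sup>+q. \<integral>\<^sup>+\<omega>. (\<Prod>i<n. indicator (A (Suc i)) (\<omega> i)) * h (\<omega> n) \<partial>traj q \<partial>K sa)"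
  using assms(1)
proof (induction n arbitrary: h)
  case 0
  note [measurable] = 0
  have "(\<integral>\<^sup>+\<omega>. (\<Prod>i<Suc 0. indicator (A i) (\<omega> i)) * h (\<omega> (Suc 0)) \<partial>traj sa) =
     (\<integral>\<^sup>+\<omega>. indicator (A 0) (\<omega> 0) * (\<integral>\<^sup>+q. h q \<partial>K (\<omega> 0)) \<partial>traj sa)"
    using trajectory_step[OF sa 0 A, where n="0::nat"] by simp
  also have "\<dots> = indicator (A 0) sa * (\<integral>\<^sup>+q. h q \<partial>K sa)"
    by (rule trajectory_initial[OF sa]) measurable
  also have "(\<integral>\<^sup>+q. h q \<partial>K sa) = (\<integral>\<^sup>+q. \<integral>\<^sup>+\<omega>. h (\<omega> 0) \<partial>traj q \<partial>K sa)"
    by (intro nn_integral_cong trajectory_initial[symmetric] 0) (simp add: space_K[OF sa])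
  finally show ?case by simp
next
  case (Suc n)
  note [measurable] = Suc.prems
  let ?h = "\<lambda>q. indicator (A (Suc n)) q * (\<integral>\<^sup>+x. h x \<partial>K q)"
  have h: "?h \<in> borel_measurable S" by measurable
  have "(\<integral>\<^sup>+\<omega>. (\<Prod>i<Suc (Suc n). indicator (A i) (\<omega> i)) * h (\<omega> (Suc (Suc n))) \<partial>traj sa) =
    (\<integral>\<^sup>+\<omega>. (\<Prod>i<Suc n. indicator (A i) (\<omega> i)) * ?h (\<omega> (Suc n)) \<partial>traj sa)"
    by (rule trajectory_step[OF sa Suc.prems A])
  also have "\<dots> = indicator (A 0) sa * (\<integral>\<^sup>+q. \<integral>\<^sup>+\<omega>. (\<Prod>i<n. indicator (A (Suc i)) (\<omega> i)) * ?h (\<omega> n) \<partial>traj q \<partial>K sa)"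
    by (rule Suc.IH[OF h])
  also have "(\<integral>\<^sup>+q. \<integral>\<^sup>+\<omega>. (\<Prod>i<n. indicator (A (Suc i)) (\<omega> i)) * ?h (\<omega> n) \<partial>traj q \<partial>K sa) =
     (\<integral>\<^sup>+q. \<integral>\<^sup>+\<omega>. (\<Prod>i<Suc n. indicator (A (Suc i)) (\<omega> i)) * h (\<omega> (Suc n)) \<partial>traj q \<partial>K sa)"
    by (intro nn_integral_cong trajectory_step[symmetric, OF _ Suc.prems A]) (simp add: space_K[OF sa])
  finally show ?case .
qed

lemma emeasure_trajectory_cylinder:
  assumes "sa \<in> space S" "J \<subseteq> {..<n}" "\<And>i. i \<in> J \<Longrightarrow> E i \<in> sets S"
  shows "emeasure (traj sa) (prod_emb UNIV (\<lambda>_. S) J (Pi\<^sub>E J E)) =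
    (\<integral>\<^sup>+\<omega>. (\<Prod>i<n. indicator (if i \<in> J then E i else space S) (\<omega> i)) \<partial>traj sa)"
proof -
  have "finite J" using assms(2) finite_subset by blast
  then have "prod_emb UNIV (\<lambda>_. S) J (Pi\<^sub>E J E) \<in> sets (traj sa)"
    using assms(1,3) by (auto simp: sets_trajectory intro!: sets_PiM_I)
  then have "emeasure (traj sa) (prod_emb UNIV (\<lambda>_. S) J (Pi\<^sub>E J E)) =
     (\<integral>\<^sup>+\<omega>. indicator (prod_emb UNIV (\<lambda>_. S) J (Pi\<^sub>E J E)) \<omega> \<partial>traj sa)"
    by simp
  also have "\<dots> = (\<integral>\<^sup>+\<omega>. (\<Prod>i<n. indicator (if i \<in> J then E i else space S) (\<omega> i)) \<partial>traj sa)"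
    using sets_eq_imp_space_eq[OF sets_trajectory[OF assms(1)]]
    by (intro nn_integral_cong indicator_prod_emb_cylinder assms(2)) simp
  finally show ?thesis .
qed

text \<open>Cylinders are stable under intersection and generate the path space, so measurability on
  them suffices. This makes trajectories a kernel that can be composed with
  \<open>K\<close>.\<close>

lemma measurable_trajectory[measurable]: "traj \<in> S \<rightarrow>\<^sub>M prob_algebra Path"
proof (rule measurable_prob_algebra_generated[OF sets_PiM Int_stable_prod_algebra prod_algebra_sets_into_space])
  fix X assume "X \<in> prod_algebra UNIV (\<lambda>_::nat. S)"
  then obtain J E where X: "X = prod_emb UNIV (\<lambda>_. S) J (Pi\<^sub>E J E)" "finite J" "\<And>i. i \<in> J \<Longrightarrow> E i \<in> sets S"
    by (auto elim!: prod_algebraE)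
  from X(2) obtain n where n: "J \<subseteq> {..<n}"
    by (auto dest: finite_nat_iff_bounded[THEN iffD1])
  have "(\<lambda>sa. \<integral>\<^sup>+\<omega>. (\<Prod>i<n. indicator (if i \<in> J then E i else space S) (\<omega> i)) * 1 \<partial>traj sa) \<in> borel_measurable S"
    by (rule measurable_nn_integral_trajectory_cylinder) (auto simp: X(3))
  then show "(\<lambda>sa. emeasure (traj sa) X) \<in> borel_measurable S"
    by (subst measurable_cong[where g="\<lambda>sa. \<integral>\<^sup>+\<omega>. (\<Prod>i<n. indicator (if i \<in> J then E i else space S) (\<omega> i)) \<partial>traj sa"])
       (auto simp: X(1) intro!: emeasure_trajectory_cylinder n X(3))
qed (auto simp: sets_trajectory prob_space_trajectory)

lemma trajectory_subprob[measurable]: "traj \<in> S \<rightarrow>\<^sub>M subprob_algebra Path"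
  by (rule measurable_prob_algebraD) measurable

text \<open>Measures on the path space are determined by cylinders, and the preimage of a cylinder
  under \<open>case_nat sa\<close> splits into a condition on \<open>sa\<close> and a cylinder for
  the remaining path.\<close>

lemma trajectory_Markov:
  assumes sa: "sa \<in> space S"
  shows "traj sa = distr (K sa \<bind> traj) Path (case_nat sa)"
proof (rule measure_eqI_PiM_infinite)
  have ne: "space (K sa) \<noteq> {}" using sa space_K[OF sa] by auto
  have tm: "traj \<in> K sa \<rightarrow>\<^sub>M subprob_algebra Path"
    by (simp add: measurable_cong_sets[OF sets_K[OF sa] refl])
  have sB: "sets (K sa \<bind> traj) = sets Path"
    by (rule sets_bind[OF _ ne]) (simp add: sets_trajectory space_K[OF sa])
  have cm: "case_nat sa \<in> Path \<rightarrow>\<^sub>M Path"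
    using sa by measurable
  show "sets (traj sa) = sets Path" by (rule sets_trajectory[OF sa])
  show "sets (distr (K sa \<bind> traj) Path (case_nat sa)) = sets Path" by simp
  interpret prob_space "traj sa" by (rule prob_space_trajectory[OF sa])
  show "finite_measure (traj sa)" by unfold_locales
  fix E :: "nat \<Rightarrow> ('s \<times> 'a) set" and J :: "nat set"
  assume J: "finite J" and E: "\<And>i. i \<in> J \<Longrightarrow> E i \<in> sets S"
  let ?X = "prod_emb UNIV (\<lambda>_. S) J (Pi\<^sub>E J E)" and ?A = "\<lambda>i. if i \<in> J then E i else space S"
  have X: "?X \<in> sets Path" using J E by (auto intro!: sets_PiM_I)
  from J obtain n where n: "J \<subseteq> {..<n}"
    by (auto dest: finite_nat_iff_bounded[THEN iffD1])
  \<comment> \<open>One factor more than required, so that there is always a coordinate 0 to split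
    off, even for empty \<open>J\<close>.\<close>
  then have n': "J \<subseteq> {..<Suc n}" by auto
  have A[measurable]: "?A i \<in> sets S" for i using E by simp
  have "emeasure (distr (K sa \<bind> traj) Path (case_nat sa)) ?X = (\<integral>\<^sup>+\<omega>. indicator ?X \<omega> \<partial>distr (K sa \<bind> traj) Path (case_nat sa))"
    using X by simp
  also have "\<dots> = (\<integral>\<^sup>+\<omega>. indicator ?X (case_nat sa \<omega>) \<partial>(K sa \<bind> traj))"
    using X by (intro nn_integral_distr) (simp_all add: measurable_cong_sets[OF sB refl] cm)
  also have "\<dots> = (\<integral>\<^sup>+q. \<integral>\<^sup>+\<omega>. indicator ?X (case_nat sa \<omega>) \<partial>traj q \<partial>K sa)"
    by (rule nn_integral_bind[OF _ tm]) (use X cm in measurable)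
  also have "\<dots> = (\<integral>\<^sup>+q. \<integral>\<^sup>+\<omega>. indicator (?A 0) sa * ((\<Prod>i<n. indicator (?A (Suc i)) (\<omega> i)) * 1) \<partial>traj q \<partial>K sa)"
  proof (intro nn_integral_cong)
    fix q \<omega> assume "q \<in> space (K sa)" and w: "\<omega> \<in> space (traj q)"
    then have q: "q \<in> space S" by (simp add: space_K[OF sa])
    have "\<omega> \<in> space Path" using w sets_eq_imp_space_eq[OF sets_trajectory[OF q]] by simp
    then have "case_nat sa \<omega> \<in> space Path" by (rule measurable_space[OF cm])
    then show "indicator ?X (case_nat sa \<omega>) = indicator (?A 0) sa * ((\<Prod>i<n. indicator (?A (Suc i)) (\<omega> i)) * 1 :: ennreal)"
      by (subst indicator_prod_emb_cylinder[OF n']) (simp_all only: prod.lessThan_Suc_shift nat.case mult_1_right o_def)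
  qed
  also have "\<dots> = indicator (?A 0) sa * (\<integral>\<^sup>+q. \<integral>\<^sup>+\<omega>. (\<Prod>i<n. indicator (?A (Suc i)) (\<omega> i)) * 1 \<partial>traj q \<partial>K sa)"
    by (simp add: indicator_def)
  also have "\<dots> = (\<integral>\<^sup>+\<omega>. (\<Prod>i<Suc n. indicator (?A i) (\<omega> i)) * 1 \<partial>traj sa)"
    by (rule trajectory_cylinder_shift[symmetric, where h="\<lambda>_. 1"]) (auto simp: sa E)
  also have "\<dots> = emeasure (traj sa) ?X"
    by (simp only: emeasure_trajectory_cylinder[OF sa n' E] mult_1_right)
  finally show "emeasure (traj sa) ?X = emeasure (distr (K sa \<bind> traj) Path (case_nat sa)) ?X" ..
qed

lemma nn_integral_trajectory_Markov:
  assumes sa: "sa \<in> space S" and f[measurable]: "f \<in> borel_measurable Path"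
  shows "(\<integral>\<^sup>+\<omega>. f \<omega> \<partial>traj sa) = (\<integral>\<^sup>+q. \<integral>\<^sup>+\<omega>. f (case_nat sa \<omega>) \<partial>traj q \<partial>K sa)"
proof -
  have ne: "space (K sa) \<noteq> {}" using sa space_K[OF sa] by auto
  have sB: "sets (K sa \<bind> traj) = sets Path"
    by (rule sets_bind[OF _ ne]) (simp add: sets_trajectory space_K[OF sa])
  have cm[measurable]: "case_nat sa \<in> Path \<rightarrow>\<^sub>M Path"
    using sa by measurable
  have "(\<integral>\<^sup>+\<omega>. f \<omega> \<partial>traj sa) = (\<integral>\<^sup>+\<omega>. f (case_nat sa \<omega>) \<partial>(K sa \<bind> traj))"
    by (subst trajectory_Markov[OF sa], rule nn_integral_distr) (simp_all add: measurable_cong_sets[OF sB refl])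
  also have "\<dots> = (\<integral>\<^sup>+q. \<integral>\<^sup>+\<omega>. f (case_nat sa \<omega>) \<partial>traj q \<partial>K sa)"
    by (rule nn_integral_bind[where B=Path]) (simp_all add: measurable_cong_sets[OF sets_K[OF sa] refl])
  finally show ?thesis .
qed

text \<open>Singletons need not be measurable, so \<open>\<omega> 0 = q\<close> cannot be asserted almost surely; the Markov
  property in the form \<open>case_nat\<close> puts the starting point in place pointwise instead.\<close>

lemma nn_integral_trajectory_start:
  assumes q: "q \<in> space S" and f[measurable]: "(\<lambda>(p, \<omega>). f p \<omega>) \<in> borel_measurable (S \<Otimes>\<^sub>M Path)"
  shows "(\<integral>\<^sup>+\<omega>. f (\<omega> 0) \<omega> \<partial>traj q) = (\<integral>\<^sup>+\<omega>. f q \<omega> \<partial>traj q)"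
proof -
  have "(\<lambda>\<omega>. f (\<omega> 0) \<omega>) \<in> borel_measurable Path" "(\<lambda>\<omega>. f q \<omega>) \<in> borel_measurable Path"
    using q by measurable
  then show ?thesis
    by (simp add: nn_integral_trajectory_Markov[OF q])
qed

section \<open>The CDF Bellman operator\<close>

abbreviation \<gamma> where "\<gamma> \<equiv> discount M"

lemma discount_pos: "0 < \<gamma>" and discount_less_1: "\<gamma> < 1"
  using mdp by (auto simp: discounted_mdp_def)

text \<open>The inverse of the affine map z \<mapsto> r + \<gamma> (z - \<alpha> log \<pi>) that
  turns the return after the transition into the return before it.\<close>

definition pull :: "real \<Rightarrow> 's \<times> 'a \<Rightarrow> 's \<times> 'a \<Rightarrow> real \<Rightarrow> real" where
  "pull \<alpha> sa q x = (x - step_reward M sa q) / \<gamma> + \<alpha> * log_policy \<pi> q"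

lemma pull_measurable[measurable (raw)]:
  assumes [measurable]: "f \<in> N \<rightarrow>\<^sub>M S" "g \<in> N \<rightarrow>\<^sub>M S" "h \<in> borel_measurable N"
  shows "(\<lambda>z. pull \<alpha> (f z) (g z) (h z)) \<in> borel_measurable N"
  unfolding pull_def by measurable

lemma pull_mono: "x \<le> y \<Longrightarrow> pull \<alpha> sa q x \<le> pull \<alpha> sa q y"
  using discount_pos by (simp add: pull_def divide_right_mono)

lemma pull_strict_mono: "x < y \<Longrightarrow> pull \<alpha> sa q x < pull \<alpha> sa q y"
  using discount_pos by (simp add: pull_def divide_strict_right_mono)

text \<open>The step at 0 is pulled back to a step at the shift whose expected absolute value is
  assumed bounded.\<close>

lemma pull_nonneg_iff: "0 \<le> pull \<alpha> sa q x \<longleftrightarrow> step_reward M sa q - \<gamma> * \<alpha> * log_policy \<pi> q \<le> x"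
  using discount_pos by (auto simp: pull_def field_simps)

lemma pull_affine: "pull \<alpha> sa q x = (\<alpha> * log_policy \<pi> q - step_reward M sa q / \<gamma>) + (1 / \<gamma>) * x"
  by (simp add: pull_def diff_divide_distrib)

text \<open>Substitution with slope 1/\<gamma>; the factor \<gamma> is the contraction
  constant.\<close>

lemma nn_integral_pull:
  assumes [measurable]: "f \<in> borel_measurable borel"
  shows "(\<integral>\<^sup>+x. f (pull \<alpha> sa q x) \<partial>lborel) = ennreal \<gamma> * (\<integral>\<^sup>+y. f y \<partial>lborel)"
proof -
  have "(\<integral>\<^sup>+y. f y \<partial>lborel) = ennreal \<bar>1 / \<gamma>\<bar> * (\<integral>\<^sup>+x. f (pull \<alpha> sa q x) \<partial>lborel)"
    unfolding pull_affine using discount_pos by (intro nn_integral_real_affine) auto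
  then have "ennreal \<gamma> * (\<integral>\<^sup>+y. f y \<partial>lborel) = (ennreal \<gamma> * ennreal (1 / \<gamma>)) * (\<integral>\<^sup>+x. f (pull \<alpha> sa q x) \<partial>lborel)"
    using discount_pos by (simp add: mult.assoc)
  also have "ennreal \<gamma> * ennreal (1 / \<gamma>) = 1"
    using discount_pos by (simp add: ennreal_mult[symmetric])
  finally show ?thesis by simp
qed

text \<open>Jensen for each x, exchange of the integrals, then the affine substitution for each next
  pair. Taken with a difference of fields it gives the contraction, with a centred field the energy
  bound.\<close>

lemma nn_integral_mixture_sq_le:
  assumes sa: "sa \<in> space S"
    and meas: "(\<lambda>z. u (fst z) (pull \<alpha> sa (fst z) (snd z))) \<in> borel_measurable (S \<Otimes>\<^sub>M lborel)"
    and um: "\<And>q. q \<in> space S \<Longrightarrow> u q \<in> borel_measurable borel"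
    and bound: "\<And>q y. q \<in> space S \<Longrightarrow> \<bar>u q y\<bar> \<le> (1::real)"
    and C: "\<And>q. q \<in> space S \<Longrightarrow> (\<integral>\<^sup>+y. ennreal ((u q y)\<^sup>2) \<partial>lborel) \<le> C"
  shows "(\<integral>\<^sup>+x. ennreal ((\<integral>q. u q (pull \<alpha> sa q x) \<partial>K sa)\<^sup>2) \<partial>lborel) \<le> ennreal \<gamma> * C"
proof -
  interpret P: prob_space "K sa" by (rule prob_space_K[OF sa])
  interpret PP: pair_sigma_finite "K sa" lborel
    by (intro pair_sigma_finite.intro P.sigma_finite_measure_axioms sigma_finite_lborel)
  have sets_eq: "sets (K sa \<Otimes>\<^sub>M lborel) = sets (S \<Otimes>\<^sub>M lborel)"
    by (rule sets_pair_measure_cong[OF sets_K[OF sa] refl])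
  have m[measurable]: "(\<lambda>z. u (fst z) (pull \<alpha> sa (fst z) (snd z))) \<in> borel_measurable (K sa \<Otimes>\<^sub>M lborel)"
    using meas by (simp add: measurable_cong_sets[OF sets_eq refl])
  have mx: "(\<lambda>q. u q (pull \<alpha> sa q x)) \<in> borel_measurable (K sa)" for x
    using measurable_compose[OF _ m, of "\<lambda>q. (q, x)" "K sa"] by simp
  have "(\<integral>\<^sup>+x. ennreal ((\<integral>q. u q (pull \<alpha> sa q x) \<partial>K sa)\<^sup>2) \<partial>lborel)
     \<le> (\<integral>\<^sup>+x. \<integral>\<^sup>+q. ennreal ((u q (pull \<alpha> sa q x))\<^sup>2) \<partial>K sa \<partial>lborel)"
    by (intro nn_integral_mono P.expectation_sq_le mx bound) (simp add: space_K[OF sa])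
  also have "\<dots> = (\<integral>\<^sup>+q. \<integral>\<^sup>+x. ennreal ((u q (pull \<alpha> sa q x))\<^sup>2) \<partial>lborel \<partial>K sa)"
    by (rule PP.Fubini') (simp add: case_prod_unfold)
  also have "\<dots> \<le> (\<integral>\<^sup>+q. ennreal \<gamma> * C \<partial>K sa)"
  proof (rule nn_integral_mono)
    fix q assume "q \<in> space (K sa)"
    then have q: "q \<in> space S" by (simp add: space_K[OF sa])
    have "(\<integral>\<^sup>+x. ennreal ((u q (pull \<alpha> sa q x))\<^sup>2) \<partial>lborel) = ennreal \<gamma> * (\<integral>\<^sup>+y. ennreal ((u q y)\<^sup>2) \<partial>lborel)"
      by (rule nn_integral_pull) (use um[OF q] in measurable)
    also have "\<dots> \<le> ennreal \<gamma> * C"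
      by (intro mult_left_mono C q) simp
    finally show "(\<integral>\<^sup>+x. ennreal ((u q (pull \<alpha> sa q x))\<^sup>2) \<partial>lborel) \<le> ennreal \<gamma> * C" .
  qed
  also have "\<dots> = ennreal \<gamma> * C"
    by (simp add: P.emeasure_space_1)
  finally show ?thesis .
qed

lemma bellman_mean_pull: "bellman_mean M \<pi> \<alpha> F sa x = (\<integral>q. F q (pull \<alpha> sa q x) \<partial>K sa)"
  by (simp add: bellman_mean_def pull_def)

lemma X_cdf_pull_measurable:
  assumes F: "F \<in> X_cdf M" and sa: "sa \<in> space S"
  shows "(\<lambda>z. F (fst z) (pull \<alpha> sa (fst z) (snd z))) \<in> borel_measurable (S \<Otimes>\<^sub>M lborel)"
    and "(\<lambda>q. F q (pull \<alpha> sa q x)) \<in> borel_measurable (K sa)"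
    and "integrable (K sa) (\<lambda>q. F q (pull \<alpha> sa q x))"
proof -
  interpret P: prob_space "K sa" by (rule prob_space_K[OF sa])
  note [measurable_cong] = sets_K[OF sa]
  note [measurable] = sa
  show "(\<lambda>z. F (fst z) (pull \<alpha> sa (fst z) (snd z))) \<in> borel_measurable (S \<Otimes>\<^sub>M lborel)"
    by (rule X_cdf_compose_measurable[OF F]) measurable
  show m: "(\<lambda>q. F q (pull \<alpha> sa q x)) \<in> borel_measurable (K sa)"
    by (rule X_cdf_compose_measurable[OF F]) measurable
  show "integrable (K sa) (\<lambda>q. F q (pull \<alpha> sa q x))"
    by (rule P.integrable_const_bound[of _ 1])
       (auto simp: m space_K[OF sa] Gamma_F_nonneg[OF X_cdf_Gamma_F[OF F]] Gamma_F_le_1[OF X_cdf_Gamma_F[OF F]])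
qed

lemma bellman_mean_diff_le:
  assumes F: "F \<in> X_cdf M" and G: "G \<in> X_cdf M" and sa: "sa \<in> space S"
    and C: "\<And>q. q \<in> space S \<Longrightarrow> (\<integral>\<^sup>+y. ennreal ((F q y - G q y)\<^sup>2) \<partial>lborel) \<le> C"
  shows "(\<integral>\<^sup>+x. ennreal ((bellman_mean M \<pi> \<alpha> F sa x - bellman_mean M \<pi> \<alpha> G sa x)\<^sup>2) \<partial>lborel) \<le> ennreal \<gamma> * C"
proof -
  have "bellman_mean M \<pi> \<alpha> F sa x - bellman_mean M \<pi> \<alpha> G sa x =
      (\<integral>q. (F q (pull \<alpha> sa q x) - G q (pull \<alpha> sa q x)) \<partial>K sa)" for x
    unfolding bellman_mean_pull
    by (rule Bochner_Integration.integral_diff[symmetric]) (rule X_cdf_pull_measurable F G sa)+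
  moreover have "(\<integral>\<^sup>+x. ennreal ((\<integral>q. (F q (pull \<alpha> sa q x) - G q (pull \<alpha> sa q x)) \<partial>K sa)\<^sup>2) \<partial>lborel) \<le> ennreal \<gamma> * C"
  proof (rule nn_integral_mixture_sq_le[OF sa, where u="\<lambda>q y. F q y - G q y"])
    show "(\<lambda>z. F (fst z) (pull \<alpha> sa (fst z) (snd z)) - G (fst z) (pull \<alpha> sa (fst z) (snd z))) \<in> borel_measurable (S \<Otimes>\<^sub>M lborel)"
      by (intro borel_measurable_diff X_cdf_pull_measurable F G sa)
    fix q assume q: "q \<in> space S"
    note FG = X_cdf_Gamma_F[OF F q] X_cdf_Gamma_F[OF G q]
    show "(\<lambda>y. F q y - G q y) \<in> borel_measurable borel"
      by (intro borel_measurable_diff Gamma_F_measurable FG)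
    show "\<bar>F q y - G q y\<bar> \<le> 1" for y
      using FG[THEN Gamma_F_nonneg, of y] FG[THEN Gamma_F_le_1, of y] by auto
  qed (rule C)
  ultimately show ?thesis by simp
qed

lemma energy_bound:
  assumes "F \<in> X_cdf M"
  obtains C where "C < \<infinity>" "\<And>q. q \<in> space S \<Longrightarrow> centred_energy (F q) \<le> C"
  by (rule that[OF X_cdf_energy[OF assms] SUP_upper])

lemma T_cdf_fixed_point_unique:
  assumes F: "F \<in> X_cdf M" and G: "G \<in> X_cdf M"
    and TF: "T_cdf M \<pi> \<alpha> F = F" and TG: "T_cdf M \<pi> \<alpha> G = G"
  shows "F = G"
proof -
  let ?D = "\<lambda>q. \<integral>\<^sup>+y. ennreal ((F q y - G q y)\<^sup>2) \<partial>lborel"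
  let ?C = "SUP q\<in>space S. ?D q"
  obtain CF where "CF < \<infinity>" and CF: "\<And>q. q \<in> space S \<Longrightarrow> centred_energy (F q) \<le> CF"
    using energy_bound[OF F] by blast
  moreover obtain CG where "CG < \<infinity>" and CG: "\<And>q. q \<in> space S \<Longrightarrow> centred_energy (G q) \<le> CG"
    using energy_bound[OF G] by blast
  ultimately have fin: "CF < \<infinity>" "CG < \<infinity>" by simp_all
  \<comment> \<open>Finiteness comes first, since \<open>?C = \<infinity>\<close> would be
    compatible with the contraction estimate. The step function cancels in the difference of the
    centred CDFs.\<close>
  have "?D q \<le> 2 * CF + 2 * CG" if q: "q \<in> space S" for q
  proof -
    note [measurable] = Gamma_F_measurable[OF X_cdf_Gamma_F[OF F q]] Gamma_F_measurable[OF X_cdf_Gamma_F[OF G q]]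
    have "?D q = (\<integral>\<^sup>+y. ennreal ((centre (F q) y + - centre (G q) y)\<^sup>2) \<partial>lborel)"
      by (simp add: centre_def)
    also have "\<dots> \<le> 2 * centred_energy (F q) + 2 * centred_energy (G q)"
      using nn_integral_sq_add_le[of "centre (F q)" "\<lambda>y. - centre (G q) y"] by (simp add: centred_energy_def)
    also have "\<dots> \<le> 2 * CF + 2 * CG"
      by (intro add_mono mult_left_mono CF CG q) auto
    finally show ?thesis .
  qed
  then have "?C \<le> 2 * CF + 2 * CG" by (rule SUP_least)
  also have "\<dots> < \<infinity>" using fin by (simp add: ennreal_mult_less_top)
  finally have "?C < \<infinity>" .
  have contr: "?D sa \<le> ennreal \<gamma> * ?C" if sa: "sa \<in> space S" for sa
  proof -
    have eq: "bellman_mean M \<pi> \<alpha> F sa = F sa" "bellman_mean M \<pi> \<alpha> G sa = G sa"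
      using fun_cong[OF TF, of sa] fun_cong[OF TG, of sa] sa by (simp_all add: T_cdf_def)
    have "?D q \<le> ?C" if "q \<in> space S" for q
      using that by (rule SUP_upper)
    from bellman_mean_diff_le[OF F G sa this, of \<alpha>] show ?thesis
      unfolding eq .
  qed
  then have "?C \<le> ennreal \<gamma> * ?C" by (rule SUP_least)
  moreover obtain c where c: "?C = ennreal c" "0 \<le> c"
    using \<open>?C < \<infinity>\<close> by (cases ?C) auto
  ultimately have "c \<le> \<gamma> * c"
    using discount_pos by (simp add: ennreal_mult[symmetric])
  then have "(1 - \<gamma>) * c \<le> 0" by (simp add: algebra_simps)
  then have "c = 0" using c(2) discount_less_1 by (simp add: mult_le_0_iff)
  then have D0: "?D q = 0" if "q \<in> space S" for q
    using contr[OF that] c by simp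
  have "F q = G q" if q: "q \<in> space S" for q
  proof (rule Gamma_F_eqI)
    show FG: "F q \<in> Gamma_F" "G q \<in> Gamma_F" by (rule X_cdf_Gamma_F[OF F q] X_cdf_Gamma_F[OF G q])+
    note [measurable] = FG[THEN Gamma_F_measurable]
    show "AE x in lborel. F q x = G q x"
      using D0[OF q] by (simp add: nn_integral_0_iff_AE)
  qed
  then show ?thesis
    by (rule extensionalityI[OF X_cdf_extensional[OF F] X_cdf_extensional[OF G]])
qed

section \<open>Preservation of \<open>Gamma_F\<close> by the Bellman operator\<close>

lemma filterlim_pull_at_right: "filterlim (pull \<alpha> sa q) (at_right (pull \<alpha> sa q x)) (at_right x)"
proof -
  have "(pull \<alpha> sa q \<longlongrightarrow> pull \<alpha> sa q x) (at_right x)"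
    unfolding pull_def using discount_pos by (intro tendsto_intros) auto
  moreover have "\<forall>\<^sub>F y in at_right x. pull \<alpha> sa q y \<in> {pull \<alpha> sa q x<..} \<and> pull \<alpha> sa q y \<noteq> pull \<alpha> sa q x"
    using eventually_at_right_less[of x]
    by eventually_elim (simp add: pull_strict_mono less_imp_neq[OF pull_strict_mono, symmetric])
  ultimately show ?thesis
    by (simp add: filterlim_at)
qed

lemma filterlim_pull_at_top: "filterlim (pull \<alpha> sa q) at_top at_top"
  unfolding pull_affine using discount_pos
  by (intro filterlim_tendsto_add_at_top[OF tendsto_const] filterlim_tendsto_pos_mult_at_top[OF tendsto_const] filterlim_ident) auto

lemma filterlim_pull_at_bot: "filterlim (pull \<alpha> sa q) at_bot at_bot"
  unfolding pull_affine filterlim_tendsto_add_at_bot_iff[OF tendsto_const] using discount_pos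
  by (intro filterlim_tendsto_pos_mult_at_bot[OF tendsto_const] filterlim_ident) auto

text \<open>Dominated convergence with bound 1, phrased for an arbitrary sequence of arguments so
  that it yields right continuity and both limits at infinity.\<close>

lemma bellman_mean_tendsto:
  assumes F: "F \<in> X_cdf M" and sa: "sa \<in> space S"
    and lim: "\<And>q. q \<in> space S \<Longrightarrow> (\<lambda>n. F q (pull \<alpha> sa q (X n))) \<longlonglongrightarrow> L q"
  shows "(\<lambda>n. bellman_mean M \<pi> \<alpha> F sa (X n)) \<longlonglongrightarrow> (\<integral>q. L q \<partial>K sa)"
  unfolding bellman_mean_pull
proof (rule integral_dominated_convergence[where w="\<lambda>_. 1"])
  interpret P: prob_space "K sa" by (rule prob_space_K[OF sa])
  show "integrable (K sa) (\<lambda>_. 1::real)" by simp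
  show "(\<lambda>q. F q (pull \<alpha> sa q (X n))) \<in> borel_measurable (K sa)" for n
    by (rule X_cdf_pull_measurable[OF F sa])
  then show "L \<in> borel_measurable (K sa)"
    by (intro borel_measurable_LIMSEQ_real[where u="\<lambda>n q. F q (pull \<alpha> sa q (X n))" and u'=L])
       (simp_all add: lim space_K[OF sa])
  show "AE q in K sa. (\<lambda>n. F q (pull \<alpha> sa q (X n))) \<longlonglongrightarrow> L q"
    by (rule AE_I2) (simp add: lim space_K[OF sa])
  show "AE q in K sa. norm (F q (pull \<alpha> sa q (X n))) \<le> 1" for n
    by (rule AE_I2) (simp add: space_K[OF sa] Gamma_F_nonneg[OF X_cdf_Gamma_F[OF F]] Gamma_F_le_1[OF X_cdf_Gamma_F[OF F]])
qed

text \<open>The increasing affine pullback preserves monotonicity, right continuity and the two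
  limits, and so does averaging over \<open>K sa\<close>. The distribution is the Lebesgue-Stieltjes
  measure of the result.\<close>

lemma bellman_mean_distribution:
  assumes F: "F \<in> X_cdf M" and sa: "sa \<in> space S"
  shows "\<exists>\<mu>. real_distribution \<mu> \<and> bellman_mean M \<pi> \<alpha> F sa = cdf \<mu>"
proof -
  let ?B = "bellman_mean M \<pi> \<alpha> F sa"
  interpret P: prob_space "K sa" by (rule prob_space_K[OF sa])
  note \<Gamma> = X_cdf_Gamma_F[OF F]
  have mono: "?B x \<le> ?B y" if "x \<le> y" for x y
    unfolding bellman_mean_pull
    by (intro integral_mono X_cdf_pull_measurable F sa) (simp add: space_K[OF sa] Gamma_F_mono[OF \<Gamma>] pull_mono[OF that])
  have right: "continuous (at_right a) ?B" for a
    unfolding continuous_within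
  proof (rule tendsto_at_right_sequentially[where b="a + 1"])
    fix X :: "nat \<Rightarrow> real" assume X: "\<And>n. a < X n" "X \<longlonglongrightarrow> a"
    then have X_right: "filterlim X (at_right a) sequentially"
      by (simp add: filterlim_at less_imp_neq[symmetric])
    have "((\<lambda>x. F q (pull \<alpha> sa q x)) \<longlongrightarrow> F q (pull \<alpha> sa q a)) (at_right a)" if "q \<in> space S" for q
      using Gamma_F_continuous[OF \<Gamma>[OF that], of "pull \<alpha> sa q a"]
      by (intro filterlim_compose[OF _ filterlim_pull_at_right]) (simp add: continuous_within)
    from filterlim_compose[OF this X_right]
    have "(\<lambda>n. F q (pull \<alpha> sa q (X n))) \<longlonglongrightarrow> F q (pull \<alpha> sa q a)" if "q \<in> space S" for q
      using that .
    from bellman_mean_tendsto[OF F sa this] show "(\<lambda>n. ?B (X n)) \<longlonglongrightarrow> ?B a"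
      by (simp add: bellman_mean_pull)
  qed simp
  have top: "(?B \<longlongrightarrow> 1) at_top"
  proof (rule tendsto_at_topI_sequentially)
    fix X :: "nat \<Rightarrow> real" assume X: "filterlim X at_top sequentially"
    have "(\<lambda>n. F q (pull \<alpha> sa q (X n))) \<longlonglongrightarrow> 1" if "q \<in> space S" for q
      by (intro filterlim_compose[OF Gamma_F_at_top[OF \<Gamma>[OF that]]] filterlim_compose[OF filterlim_pull_at_top X])
    from bellman_mean_tendsto[OF F sa this] show "(\<lambda>n. ?B (X n)) \<longlonglongrightarrow> 1"
      by (simp add: P.prob_space)
  qed
  have bot: "(?B \<longlongrightarrow> 0) at_bot"
  proof (rule tendsto_at_botI_sequentially)
    fix X :: "nat \<Rightarrow> real" assume X: "filterlim X at_bot sequentially"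
    have "(\<lambda>n. F q (pull \<alpha> sa q (X n))) \<longlonglongrightarrow> 0" if "q \<in> space S" for q
      by (intro filterlim_compose[OF Gamma_F_at_bot[OF \<Gamma>[OF that]]] filterlim_compose[OF filterlim_pull_at_bot X])
    from bellman_mean_tendsto[OF F sa this] show "(\<lambda>n. ?B (X n)) \<longlonglongrightarrow> 0"
      by simp
  qed
  show ?thesis
    by (intro exI[of _ "interval_measure ?B"] conjI real_distribution_interval_measure
        cdf_interval_measure[symmetric] mono right bot top)
qed

text \<open>Steps jumping at 0 and at c differ only between these points, by one, so their squared
  L^2 distance is at most |c|. Jensen and Tonelli carry this over to the average.\<close>

lemma nn_integral_shifted_step_le:
  assumes sa: "sa \<in> space S"
  shows "(\<integral>\<^sup>+x. ennreal ((\<integral>q. (indicator {0..} (pull \<alpha> sa q x) - indicator {0..} x) \<partial>K sa)\<^sup>2) \<partial>lborel)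
    \<le> (\<integral>\<^sup>+q. ennreal \<bar>step_reward M sa q - \<gamma> * \<alpha> * log_policy \<pi> q\<bar> \<partial>K sa)"
proof -
  interpret P: prob_space "K sa" by (rule prob_space_K[OF sa])
  interpret PP: pair_sigma_finite "K sa" lborel
    by (intro pair_sigma_finite.intro P.sigma_finite_measure_axioms sigma_finite_lborel)
  note [measurable_cong] = sets_K[OF sa]
  note [measurable] = sa
  let ?c = "\<lambda>q. step_reward M sa q - \<gamma> * \<alpha> * log_policy \<pi> q"
  let ?d = "\<lambda>q x. indicator {0..} (pull \<alpha> sa q x) - indicator {0..} x :: real"
  have "(\<integral>\<^sup>+x. ennreal ((\<integral>q. ?d q x \<partial>K sa)\<^sup>2) \<partial>lborel) \<le> (\<integral>\<^sup>+x. \<integral>\<^sup>+q. ennreal ((?d q x)\<^sup>2) \<partial>K sa \<partial>lborel)"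
    by (intro nn_integral_mono P.expectation_sq_le) (measurable, simp add: indicator_def)
  also have "\<dots> = (\<integral>\<^sup>+q. \<integral>\<^sup>+x. ennreal ((?d q x)\<^sup>2) \<partial>lborel \<partial>K sa)"
    by (rule PP.Fubini') measurable
  also have "\<dots> \<le> (\<integral>\<^sup>+q. ennreal \<bar>?c q\<bar> \<partial>K sa)"
  proof (rule nn_integral_mono)
    fix q
    have "(\<integral>\<^sup>+x. ennreal ((?d q x)\<^sup>2) \<partial>lborel) \<le> (\<integral>\<^sup>+x. indicator {min 0 (?c q)..max 0 (?c q)} x \<partial>lborel)"
      by (rule nn_integral_mono) (auto simp: indicator_def pull_nonneg_iff)
    also have "\<dots> = ennreal \<bar>?c q\<bar>"
      by (auto simp: min_def max_def)
    finally show "(\<integral>\<^sup>+x. ennreal ((?d q x)\<^sup>2) \<partial>lborel) \<le> ennreal \<bar>?c q\<bar>" .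
  qed
  finally show ?thesis .
qed

text \<open>The centred image is the sum of the average \<open>?f\<close> of the centred pulled-back
  CDFs, of energy at most \<gamma> times the bound for the field, and the average \<open>?g\<close>
  of the pulled-back step minus the step, controlled by the expected shift.\<close>

lemma bellman_mean_Gamma_F:
  assumes F: "F \<in> X_cdf M" and sa: "sa \<in> space S"
    and fin: "(\<integral>\<^sup>+q. ennreal \<bar>step_reward M sa q - \<gamma> * \<alpha> * log_policy \<pi> q\<bar> \<partial>K sa) < \<infinity>"
  shows "bellman_mean M \<pi> \<alpha> F sa \<in> Gamma_F"
proof -
  let ?B = "bellman_mean M \<pi> \<alpha> F sa"
  interpret P: prob_space "K sa" by (rule prob_space_K[OF sa])
  note [measurable_cong] = sets_K[OF sa]
  note [measurable] = sa
  note \<Gamma> = X_cdf_Gamma_F[OF F]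
  let ?f = "\<lambda>x. \<integral>q. centre (F q) (pull \<alpha> sa q x) \<partial>K sa"
  let ?g = "\<lambda>x. \<integral>q. (indicator {0..} (pull \<alpha> sa q x) - indicator {0..} x) \<partial>K sa :: real"
  have m: "(\<lambda>z. centre (F (fst z)) (pull \<alpha> sa (fst z) (snd z))) \<in> borel_measurable (S \<Otimes>\<^sub>M lborel)"
    unfolding centre_def by (rule borel_measurable_diff[OF X_cdf_pull_measurable(1)[OF F sa]]) measurable
  have [measurable]: "?f \<in> borel_measurable borel"
  proof -
    have "(\<lambda>z. centre (F (snd z)) (pull \<alpha> sa (snd z) (fst z))) \<in> borel_measurable (borel \<Otimes>\<^sub>M K sa)"
      using measurable_compose[OF _ m, of "\<lambda>z. (snd z, fst z)" "borel \<Otimes>\<^sub>M K sa"] by simp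
    then show ?thesis
      by (intro P.borel_measurable_lebesgue_integral) (simp add: case_prod_unfold)
  qed
  have [measurable]: "?g \<in> borel_measurable borel"
    by measurable
  have int: "integrable (K sa) (\<lambda>q. indicator {0..} (pull \<alpha> sa q x) :: real)" for x
    by (rule P.integrable_const_bound[of _ 1]) auto
  have split: "centre ?B x = ?f x + ?g x" for x
    unfolding centre_def bellman_mean_pull
    using int[of x] X_cdf_pull_measurable(3)[OF F sa, of \<alpha> x]
    by (simp add: Bochner_Integration.integral_diff P.prob_space)
  obtain C where C: "C < \<infinity>" "\<And>q. q \<in> space S \<Longrightarrow> centred_energy (F q) \<le> C"
    using energy_bound[OF F] by blast
  have "(\<integral>\<^sup>+x. ennreal ((?f x)\<^sup>2) \<partial>lborel) \<le> ennreal \<gamma> * C"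
  proof (rule nn_integral_mixture_sq_le[OF sa m])
    fix q y assume q: "q \<in> space S"
    note [measurable] = Gamma_F_measurable[OF \<Gamma>[OF q]]
    show "centre (F q) \<in> borel_measurable borel" by measurable
    show "\<bar>centre (F q) y\<bar> \<le> 1"
      using Gamma_F_nonneg[OF \<Gamma>[OF q], of y] Gamma_F_le_1[OF \<Gamma>[OF q], of y] by (auto simp: centre_def indicator_def)
    show "(\<integral>\<^sup>+y. ennreal ((centre (F q) y)\<^sup>2) \<partial>lborel) \<le> C"
      using C(2)[OF q] by (simp add: centred_energy_def)
  qed
  also have "\<dots> < \<infinity>" using C(1) by (simp add: ennreal_mult_less_top)
  finally have 1: "(\<integral>\<^sup>+x. ennreal ((?f x)\<^sup>2) \<partial>lborel) < \<infinity>" .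
  have 2: "(\<integral>\<^sup>+x. ennreal ((?g x)\<^sup>2) \<partial>lborel) < \<infinity>"
    using nn_integral_shifted_step_le[OF sa] fin by (rule le_less_trans)
  have "centred_energy ?B \<le> 2 * (\<integral>\<^sup>+x. ennreal ((?f x)\<^sup>2) \<partial>lborel) + 2 * (\<integral>\<^sup>+x. ennreal ((?g x)\<^sup>2) \<partial>lborel)"
    unfolding centred_energy_def split by (rule nn_integral_sq_add_le) measurable
  also have "\<dots> < \<infinity>" using 1 2 by (simp add: ennreal_mult_less_top)
  finally show ?thesis
    using bellman_mean_distribution[OF F sa] by (auto simp: Gamma_F_def)
qed

section \<open>The soft return along a path with a prepended pair\<close>

lemma measurable_soft_return[measurable]: "soft_return M \<pi> \<alpha> \<in> borel_measurable Path"
  unfolding soft_return_def return_term_def by measurable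

text \<open>Prepending a pair turns the immediate reward of \<omega> into part of the summand of
  index 0, which also charges the logarithm at \<open>\<omega> 0\<close>; a return never charges the
  logarithm at its own start. All later summands gain a factor \<gamma>. Convergence is essential,
  since the sum of a divergent series is an unspecified value.\<close>

lemma soft_return_case_nat:
  assumes "summable (return_term M \<pi> \<alpha> \<omega>)"
  shows "soft_return M \<pi> \<alpha> (case_nat sa \<omega>) =
    step_reward M sa (\<omega> 0) + \<gamma> * (soft_return M \<pi> \<alpha> \<omega> - \<alpha> * log_policy \<pi> (\<omega> 0))"
proof -
  let ?r = "return_term M \<pi> \<alpha>"
  have Suc: "?r (case_nat sa \<omega>) (Suc k) = \<gamma> * ?r \<omega> k" for k
    by (simp add: return_term_def)
  then have "summable (\<lambda>k. ?r (case_nat sa \<omega>) (Suc k))"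
    using assms by (simp add: summable_mult)
  then have "summable (?r (case_nat sa \<omega>))"
    by (simp only: summable_Suc_iff)
  from suminf_split_head[OF this]
  have "(\<Sum>k. ?r (case_nat sa \<omega>) k) = ?r (case_nat sa \<omega>) 0 + \<gamma> * (\<Sum>k. ?r \<omega> k)"
    unfolding Suc using suminf_mult[OF assms, of \<gamma>] by simp
  then show ?thesis
    by (simp add: soft_return_def return_term_def[of _ _ _ _ 0] algebra_simps)
qed

lemma soft_return_case_nat_le_iff:
  assumes "summable (return_term M \<pi> \<alpha> \<omega>)"
  shows "soft_return M \<pi> \<alpha> (case_nat sa \<omega>) \<le> x \<longleftrightarrow> soft_return M \<pi> \<alpha> \<omega> \<le> pull \<alpha> sa (\<omega> 0) x"
  unfolding soft_return_case_nat[OF assms] pull_def using discount_pos by (simp add: field_simps)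

lemma soft_return_cdf_nn_integral:
  assumes q: "q \<in> space S"
  shows "ennreal (soft_return_cdf M \<pi> \<alpha> q y) = (\<integral>\<^sup>+\<omega>. indicator {..y} (soft_return M \<pi> \<alpha> \<omega>) \<partial>traj q)"
proof -
  interpret prob_space "traj q" by (rule prob_space_trajectory[OF q])
  have m: "soft_return M \<pi> \<alpha> \<in> borel_measurable (traj q)"
    by (simp add: measurable_cong_sets[OF sets_trajectory[OF q] refl])
  interpret D: prob_space "distr (traj q) borel (soft_return M \<pi> \<alpha>)"
    using m by (rule prob_space_distr)
  have "ennreal (soft_return_cdf M \<pi> \<alpha> q y) = emeasure (distr (traj q) borel (soft_return M \<pi> \<alpha>)) {..y}"
    using q by (simp add: soft_return_cdf_def soft_return_law_def cdf_def2 D.emeasure_eq_measure)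
  also have "\<dots> = (\<integral>\<^sup>+z. indicator {..y} z \<partial>distr (traj q) borel (soft_return M \<pi> \<alpha>))"
    by simp
  also have "\<dots> = (\<integral>\<^sup>+\<omega>. indicator {..y} (soft_return M \<pi> \<alpha> \<omega>) \<partial>traj q)"
    by (rule nn_integral_distr[OF m]) simp
  finally show ?thesis .
qed

lemma soft_return_cdf_fixed_point:
  assumes conv: "soft_return_converges M \<pi> \<alpha>" and X: "soft_return_cdf M \<pi> \<alpha> \<in> X_cdf M"
  shows "T_cdf M \<pi> \<alpha> (soft_return_cdf M \<pi> \<alpha>) = soft_return_cdf M \<pi> \<alpha>"
proof -
  let ?F = "soft_return_cdf M \<pi> \<alpha>" and ?R = "soft_return M \<pi> \<alpha>"
  have "bellman_mean M \<pi> \<alpha> ?F sa x = ?F sa x" if sa: "sa \<in> space S" for sa x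
  proof -
    note [measurable] = sa
    have "ennreal (?F sa x) = (\<integral>\<^sup>+\<omega>. indicator {..x} (?R \<omega>) \<partial>traj sa)"
      by (rule soft_return_cdf_nn_integral[OF sa])
    also have "\<dots> = (\<integral>\<^sup>+q. \<integral>\<^sup>+\<omega>. indicator {..x} (?R (case_nat sa \<omega>)) \<partial>traj q \<partial>K sa)"
      by (rule nn_integral_trajectory_Markov[OF sa]) measurable
    also have "\<dots> = (\<integral>\<^sup>+q. ennreal (?F q (pull \<alpha> sa q x)) \<partial>K sa)"
    proof (rule nn_integral_cong)
      fix q assume "q \<in> space (K sa)"
      then have q: "q \<in> space S" by (simp add: space_K[OF sa])
      have "AE \<omega> in traj q. summable (return_term M \<pi> \<alpha> \<omega>)"
        using conv q by (simp add: soft_return_converges_def)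
      \<comment> \<open>The recursion holds where the series of the shifted path converges, hence
        almost surely under \<open>traj q\<close>. The threshold still refers to
        \<open>\<omega> 0\<close>, which the next equation replaces by \<open>q\<close>.\<close>
      then have "(\<integral>\<^sup>+\<omega>. indicator {..x} (?R (case_nat sa \<omega>)) \<partial>traj q) =
          (\<integral>\<^sup>+\<omega>. (if ?R \<omega> \<le> pull \<alpha> sa (\<omega> 0) x then 1 else 0) \<partial>traj q)"
        by (intro nn_integral_cong_AE, eventually_elim) (simp add: indicator_def soft_return_case_nat_le_iff)
      also have "\<dots> = (\<integral>\<^sup>+\<omega>. (if ?R \<omega> \<le> pull \<alpha> sa q x then 1 else 0) \<partial>traj q)"
        by (rule nn_integral_trajectory_start[OF q]) measurable
      also have "\<dots> = ennreal (?F q (pull \<alpha> sa q x))"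
        unfolding soft_return_cdf_nn_integral[OF q] by (intro nn_integral_cong) (simp add: indicator_def)
      finally show "(\<integral>\<^sup>+\<omega>. indicator {..x} (?R (case_nat sa \<omega>)) \<partial>traj q) = ennreal (?F q (pull \<alpha> sa q x))" .
    qed
    also have "\<dots> = ennreal (bellman_mean M \<pi> \<alpha> ?F sa x)"
      unfolding bellman_mean_pull
      by (intro nn_integral_eq_integral X_cdf_pull_measurable X sa AE_I2)
         (simp add: space_K[OF sa] Gamma_F_nonneg[OF X_cdf_Gamma_F[OF X]])
    finally have "ennreal (?F sa x) = ennreal (bellman_mean M \<pi> \<alpha> ?F sa x)" .
    moreover have "0 \<le> ?F sa x" using Gamma_F_nonneg[OF X_cdf_Gamma_F[OF X sa]] .
    moreover have "0 \<le> bellman_mean M \<pi> \<alpha> ?F sa x"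
      unfolding bellman_mean_pull
      by (intro integral_nonneg_AE AE_I2) (simp add: space_K[OF sa] Gamma_F_nonneg[OF X_cdf_Gamma_F[OF X]])
    ultimately show ?thesis by simp
  qed
  then show ?thesis
    unfolding T_cdf_def
    by (intro extensionalityI[OF restrict_extensional X_cdf_extensional[OF X]]) (simp add: fun_eq_iff)
qed

text \<open>Every element of \<open>X_adm\<close> is \<open>?V F\<close> with \<open>F\<close> in
  \<open>X_cdf\<close>, where the chosen inverse of the transport cancels; fixed points thus
  correspond to solutions of \<open>?V (?T F) = ?V F\<close>.\<close>

lemma T_spec_unique_fixed_point:
  fixes \<alpha> \<epsilon> :: real
  assumes "0 < \<epsilon>" and "soft_return_converges M \<pi> \<alpha>"
    and "(SUP sa\<in>space S. \<integral>\<^sup>+q. ennreal \<bar>step_reward M sa q - \<gamma> * \<alpha> * log_policy \<pi> q\<bar> \<partial>K sa) < \<infinity>"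
    and "soft_return_cdf M \<pi> \<alpha> \<in> X_cdf M"
  shows "let \<nu> = V_field M \<epsilon> (soft_return_cdf M \<pi> \<alpha>) in
    \<nu> \<in> X_adm M \<epsilon> \<and> T_spec M \<pi> \<alpha> \<epsilon> \<nu> = \<nu> \<and>
    (\<forall>\<nu>'\<in>X_adm M \<epsilon>. T_spec M \<pi> \<alpha> \<epsilon> \<nu>' = \<nu>' \<longrightarrow> \<nu>' = \<nu>)"
proof -
  let ?F = "soft_return_cdf M \<pi> \<alpha>" and ?V = "V_field M \<epsilon>" and ?T = "T_cdf M \<pi> \<alpha>"
  have T_spec: "T_spec M \<pi> \<alpha> \<epsilon> (?V F) = ?V (?T F)" if "F \<in> X_cdf M" for F
    using the_inv_into_f_f[OF inj_on_V_field[OF assms(1)] that] by (simp add: T_spec_def)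
  have fixed: "?T ?F = ?F"
    by (rule soft_return_cdf_fixed_point[OF assms(2,4)])
  have "?V F = ?V ?F" if F: "F \<in> X_cdf M" and "T_spec M \<pi> \<alpha> \<epsilon> (?V F) = ?V F" for F
  proof -
    have V: "?V (?T F) = ?V F" using that by (simp add: T_spec)
    \<comment> \<open>The outer transport is cancelled at each pair separately, where both values
      lie in \<open>Gamma_F\<close>; that \<open>?T F\<close> belongs to \<open>X_cdf\<close> then
      follows from \<open>?T F = F\<close>.\<close>
    have "?T F sa = F sa" if sa: "sa \<in> space S" for sa
    proof (rule inj_onD[OF V_op_inj_on_Gamma_F[OF assms(1)]])
      show "V_op \<epsilon> (?T F sa) = V_op \<epsilon> (F sa)"
        using fun_cong[OF V, of sa] sa by (simp add: V_field_def)
      have "(\<integral>\<^sup>+q. ennreal \<bar>step_reward M sa q - \<gamma> * \<alpha> * log_policy \<pi> q\<bar> \<partial>K sa) < \<infinity>"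
        using SUP_upper[OF sa] assms(3) by (rule le_less_trans)
      then show "?T F sa \<in> Gamma_F"
        using bellman_mean_Gamma_F[OF F sa] sa by (simp add: T_cdf_def)
      show "F sa \<in> Gamma_F" by (rule X_cdf_Gamma_F[OF F sa])
    qed
    then have "?T F = F"
      by (intro extensionalityI[OF _ X_cdf_extensional[OF F]]) (simp add: T_cdf_def, blast)
    then have "F = ?F"
      by (rule T_cdf_fixed_point_unique[OF F assms(4) _ fixed])
    then show ?thesis by simp
  qed
  moreover have "T_spec M \<pi> \<alpha> \<epsilon> (?V ?F) = ?V ?F"
    by (simp add: T_spec[OF assms(4)] fixed)
  ultimately show ?thesis
    unfolding Let_def X_adm_def using assms(4) by blast
qed

end

theorem corollary14:
  fixes M :: "('s, 'a) mdp" and \<pi> :: "('s, 'a) policy" and \<alpha> \<epsilon> :: real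
  assumes "discounted_mdp M"
    and "stationary_policy M \<pi>"
    and "0 < \<alpha>"
    and "0 < \<epsilon>"
    and "soft_return_converges M \<pi> \<alpha>"
    and "log_policy_well_defined M \<pi>"
    and "(SUP sa\<in>space (state_actions M).
           \<integral>\<^sup>+q. ennreal \<bar>step_reward M sa q - discount M * \<alpha> * log_policy \<pi> q\<bar> \<partial>next_pair M \<pi> sa) < \<infinity>"
    and "\<And>F x. F \<in> X_cdf M \<Longrightarrow>
           (\<lambda>sa. bellman_mean M \<pi> \<alpha> F sa x) \<in> borel_measurable (state_actions M)"
    and "soft_return_cdf M \<pi> \<alpha> \<in> X_cdf M"
  shows "let \<nu> = V_field M \<epsilon> (soft_return_cdf M \<pi> \<alpha>) in
           \<nu> \<in> X_adm M \<epsilon> \<and> T_spec M \<pi> \<alpha> \<epsilon> \<nu> = \<nu> \<and>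
           (\<forall>\<nu>'\<in>X_adm M \<epsilon>. T_spec M \<pi> \<alpha> \<epsilon> \<nu>' = \<nu>' \<longrightarrow> \<nu>' = \<nu>)"
  by (rule policy_mdp.T_spec_unique_fixed_point[OF policy_mdp.intro[OF assms(1,2)] assms(4,5,7,9)])

end
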